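(* In the cylindrical Hastings-Levitov$(0)$ process $\mathrm{CHL}_N$ with particle size $\lambda>0$, consider the particle attached at time $t_0:=t_k$ for some fixed $k\ge1$, and let $D_t$ denote the number of particles directly attached to this particle during the time interval $(t_0,t]$. Then there exists a random variable $D_\infty$ such that $D_t\to D_\infty$ almost surely as $t\to\infty$, and $\mathbb{E}[D_\infty]=1$.
   Context: Slit maps. Fix real numbers $\lambda>0$ and $N\ge 1$. Let $\mathbb T_N=\mathbb R/2\pi N\mathbb Z$, identified with $[0,2\pi N)$ and with the boundary $\{\operatorname{Im} z=0\}$ of the cylinder $\mathbb T^N=\{z\in\mathbb C:\operatorname{Im} z>0\}/(z\sim z+2\pi N)$. Put $\delta=\delta(N,\lambda)=1-\frac{2}{e^{\lambda/N}+1}\in(0,1)$. Let $\mathbb D_0=\{|z|>1\}$, $\mathbb H=\{\operatorname{Im} z>0\}$, $f_N:\mathbb T^N\to\mathbb D_0$, $f_N(z)=e^{-iz/N}$; $g:\mathbb D_0\to\mathbb H$, $g(z)=i\frac{z-1}{z+1}$; $\phi_a:\mathbb H\to\mathbb H\setminus[0,ia]$, $\phi_a(z)=\sqrt{z^2(1-a^2)-a^2}$ (conformal branch). Define $S^{N,\lambda}=f_N^{-1}\circ g^{-1}\circ\phi_{\delta}\circ g\circ f_N$, a conformal map $\mathbb T^N\to\mathbb T^N\setminus[0,i\lambda]$, extended continuously to $\mathbb T_N$; then $S^{N,\lambda}(0)=i\lambda$ and $S^{N,\lambda}(\mathbb T_N)=\mathbb T_N\cup[0,i\lambda]$. For $x\in\mathbb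 T_N$ the slit map centered at $x$ is $S^{N,\lambda}_x(z)=x+S^{N,\lambda}(z-x)$ (modulo $2\pi N$). The process $\mathrm{CHL}_N$. Let $P$ be a Poisson point process of intensity $1$ on $\mathbb R_+\times\mathbb T_N$, with points $(t_1,x_1),(t_2,x_2),\dots$, $0<t_1<t_2<\cdots$. For $t\ge0$ let $n=\#\{j:t_j\le t\}$ and $\mathcal C_t^{N,\lambda}=S^{N,\lambda}_{x_1}\circ\cdots\circ S^{N,\lambda}_{x_n}$ (identity if $n=0$). The $n$-th particle, attached at time $t_n$, is $S^{N,\lambda}_{x_1}\circ\cdots\circ S^{N,\lambda}_{x_{n-1}}([x_n,x_n+i\lambda])$. For $m>k$, the $m$-th particle is directly attached to the $k$-th particle if its base point lies on the $k$-th particle, i.e. if $S^{N,\lambda}_{x_k}\circ\cdots\circ S^{N,\lambda}_{x_{m-1}}(x_m)\in[x_k,x_k+i\lambda]$. *)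

theory Defs
  imports "HOL-Probability.Probability"
begin

text \<open>
  Points of the closed cylinder are represented by complex numbers with nonnegative imaginary
  part, two of which denote the same point if they differ by an integer multiple of
  \<open>2 \<pi> N\<close>. The slit maps respect this relation; their values are not reduced to a
  fundamental domain.
\<close>

definition delta :: "real \<Rightarrow> real \<Rightarrow> real" where
  "delta N lam = 1 - 2 / (exp (lam / N) + 1)"

definition f_map :: "real \<Rightarrow> complex \<Rightarrow> complex" where
  "f_map N z = exp (- \<i> * z / of_real N)"

text \<open>
  \<open>f_map N\<close> is a homeomorphism from the closed cylinder onto \<open>{w. norm w \<ge> 1}\<close>; its inverse is
  taken in the fundamental domain \<open>0 \<le> Re z < 2 \<pi> N\<close>.
\<close>

definition f_inv :: "real \<Rightarrow> complex \<Rightarrow> complex" where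
  "f_inv N = the_inv_into {z. 0 \<le> Im z \<and> 0 \<le> Re z \<and> Re z < 2 * pi * N} (f_map N)"

definition g_map :: "complex \<Rightarrow> complex" where
  "g_map z = \<i> * (z - 1) / (z + 1)"

definition g_inv :: "complex \<Rightarrow> complex" where
  "g_inv = the_inv_into {z. norm z > 1} g_map"

text \<open>
  The branch of \<open>sqrt (z\<^sup>2 (1 - a\<^sup>2) - a\<^sup>2)\<close> with values in the upper half-plane: \<open>csqrt\<close> has
  values in the right half-plane, and its argument here avoids the cut \<open>(-\<infinity>, 0]\<close> for
  \<open>Im z > 0\<close>, so that \<open>phi a\<close> is holomorphic there.
\<close>

definition phi :: "real \<Rightarrow> complex \<Rightarrow> complex" where
  "phi a z = \<i> * csqrt (- (z\<^sup>2 * (1 - (of_real a)\<^sup>2) - (of_real a)\<^sup>2))"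

definition slit_map_open :: "real \<Rightarrow> real \<Rightarrow> complex \<Rightarrow> complex" where
  "slit_map_open N lam = f_inv N \<circ> g_inv \<circ> phi (delta N lam) \<circ> g_map \<circ> f_map N"

text \<open>
  The continuous extension to the boundary is with respect to the topology of the cylinder, not
  that of the fundamental domain (the representatives jump by \<open>2 \<pi> N\<close> along a vertical line).
  The limit is therefore taken in the coordinate \<open>f_map N\<close>.
\<close>

definition slit_map0 :: "real \<Rightarrow> real \<Rightarrow> complex \<Rightarrow> complex" where
  "slit_map0 N lam z =
     (if Im z > 0 then slit_map_open N lam z
      else f_inv N (Lim (at z within {w. Im w > 0}) (\<lambda>w. f_map N (slit_map_open N lam w))))"

definition slit_map :: "real \<Rightarrow> real \<Rightarrow> real \<Rightarrow> complex \<Rightarrow> complex" where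
  "slit_map N lam x z = of_real x + slit_map0 N lam (z - of_real x)"

text \<open>The slit \<open>[x, x + i lam]\<close> in the cylinder, i.e. the set of all representatives of its points.\<close>

definition cyl_slit :: "real \<Rightarrow> real \<Rightarrow> real \<Rightarrow> complex set" where
  "cyl_slit N lam x =
     {Complex (x + 2 * pi * N * of_int j) s | (j :: int) s. 0 \<le> s \<and> s \<le> lam}"

text \<open>
  For a sequence of centres \<open>x\<close>, \<open>slit_comp N lam x k m\<close> is
  \<open>S\<^bsub>x k\<^esub> \<circ> \<dots> \<circ> S\<^bsub>x (m - 1)\<^esub>\<close>.
\<close>

definition slit_comp ::
    "real \<Rightarrow> real \<Rightarrow> (nat \<Rightarrow> real) \<Rightarrow> nat \<Rightarrow> nat \<Rightarrow> complex \<Rightarrow> complex" where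
  "slit_comp N lam x k m = foldr (\<lambda>j. slit_map N lam (x j)) [k..<m]"

definition directly_attached ::
    "real \<Rightarrow> real \<Rightarrow> (nat \<Rightarrow> real) \<Rightarrow> nat \<Rightarrow> nat \<Rightarrow> bool" where
  "directly_attached N lam x m k \<longleftrightarrow>
     k < m \<and> slit_comp N lam x k m (of_real (x m)) \<in> cyl_slit N lam (x k)"

text \<open>
  A Poisson point process with (diffuse) intensity measure \<open>\<mu>\<close>, as a random set of points.
  The explicit mass function also covers sets of measure zero.
\<close>

definition poisson_point_process :: "'w measure \<Rightarrow> 'a measure \<Rightarrow> ('w \<Rightarrow> 'a set) \<Rightarrow> bool" where
  "poisson_point_process M \<mu> P \<longleftrightarrow>
     prob_space M \<and>
     (AE \<omega> in M. P \<omega> \<subseteq> space \<mu>) \<and>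
     (\<forall>A \<in> sets \<mu>. emeasure \<mu> A < \<infinity> \<longrightarrow>
        (AE \<omega> in M. finite (P \<omega> \<inter> A)) \<and>
        (\<lambda>\<omega>. card (P \<omega> \<inter> A)) \<in> measurable M (count_space UNIV) \<and>
        (\<forall>n. measure M {\<omega> \<in> space M. card (P \<omega> \<inter> A) = n} =
             exp (- measure \<mu> A) * measure \<mu> A ^ n / fact n)) \<and>
     (\<forall>(r :: nat) A.
        (\<forall>i<r. A i \<in> sets \<mu> \<and> emeasure \<mu> (A i) < \<infinity>) \<and> disjoint_family_on A {..<r} \<longrightarrow>
        prob_space.indep_vars M (\<lambda>_. count_space UNIV) (\<lambda>i \<omega>. card (P \<omega> \<inter> A i)) {..<r})"

definition chl_intensity :: "real \<Rightarrow> (real \<times> real) measure" where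
  "chl_intensity N = restrict_space lborel ({0..} \<times> {0..<2 * pi * N})"

text \<open>
  The points \<open>(T n, X n)\<close>, \<open>n \<ge> 1\<close>, of a Poisson point process of intensity 1 on
  \<open>[0, \<infinity>) \<times> [0, 2 \<pi> N)\<close>, listed in the order of their time coordinates. The index 0 is unused.
\<close>

definition chl_driving ::
    "'w measure \<Rightarrow> real \<Rightarrow> (nat \<Rightarrow> 'w \<Rightarrow> real) \<Rightarrow> (nat \<Rightarrow> 'w \<Rightarrow> real) \<Rightarrow> bool" where
  "chl_driving M N T X \<longleftrightarrow>
     (\<forall>n\<ge>1. T n \<in> borel_measurable M \<and> X n \<in> borel_measurable M) \<and>
     (AE \<omega> in M. 0 < T 1 \<omega> \<and> (\<forall>n\<ge>1. T n \<omega> < T (Suc n) \<omega>)) \<and>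
     poisson_point_process M (chl_intensity N) (\<lambda>\<omega>. {(T n \<omega>, X n \<omega>) | n. n \<ge> 1})"

definition num_attached ::
    "real \<Rightarrow> real \<Rightarrow> (nat \<Rightarrow> 'w \<Rightarrow> real) \<Rightarrow> (nat \<Rightarrow> 'w \<Rightarrow> real) \<Rightarrow> nat \<Rightarrow> real \<Rightarrow> 'w \<Rightarrow> nat" where
  "num_attached N lam T X k t \<omega> =
     card {m. T m \<omega> \<in> {T k \<omega><..t} \<and> directly_attached N lam (\<lambda>n. X n \<omega>) m k}"

end

theory Submission
  imports Defs
begin

text \<open>
  Pull the attachment position of the \<open>m\<close>-th particle back through the slit maps centred at \<open>X (m - 1)\<close>,
  ..., \<open>X k\<close>. As long as the point stays on the real line, its offset from the next centre is uniform on the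
  circle and independent of the later centres, because the centres are independent and uniform. Hence
  the offsets are independent and uniform. The particle is directly attached to particle \<open>k\<close> if the
  last offset lies in the arc that is mapped to the slit and no earlier offset does: a point that has
  entered the upper half-plane never reaches a slit. If \<open>p\<close> is the normalised length of this arc, then this has
  probability \<open>p (1 - p) ^ (m - k - 1)\<close>, and these probabilities sum to 1 over \<open>m > k\<close>. Borel-Cantelli gives
  convergence, and summation gives the mean.

  That the centres are independent and uniform follows from the counting definition of the Poisson
  process by placing the first points in distinct time cells: the joint probability then factorises in
  the spatial sets, and the mesh of the cells tends to 0.
\<close>

text \<open>Two features make the argument rigid: the boundary values of the slit map are given
  through a limit and an inverse function, and the driving process is given only through counts. On
  the boundary, the tangent of the half-angle x / (2 N) is a coordinate in which the slit map
  becomes an explicit real function. This real map is extended by meaningless values on the arc, and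
  the orbit is continued formally after a hit. This does no harm: an offset in the arc at an index
  above k already rules out attachment to k, whatever follows. Uniformity of an offset comes from
  the fresh centre that is subtracted, so the real map has to be measurable and nothing more. For
  the centres, the boxes built from time cells and spatial sets, together with the rest of a large
  time-space box, have a fixed total intensity. The exponential factors therefore combine to a
  constant free of the spatial sets, and what remains is a product of lengths. The mean is 1 for
  every arc of positive length p because it is the total mass of a geometric law; the size of the
  particle affects only p.\<close>

section \<open>The slit map\<close>

text \<open>The inverse of \<open>g_map\<close>, also on the real line, where \<open>g_inv\<close> is unspecified.\<close>

definition cayley :: "complex \<Rightarrow> complex" where
  "cayley u = (\<i> + u) / (\<i> - u)"

text \<open>On the boundary \<open>g_map \<circ> f_map N\<close> is tan (x / (2 N)). The inequality
  says that the radicand of \<open>phi\<close> is negative at this value, so that the image lies on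
  the imaginary axis, which corresponds to the slit. The set is a periodic subset of the whole
  line.\<close>

definition slit_arc :: "real \<Rightarrow> real \<Rightarrow> real set" where
  "slit_arc N lam = {x. (tan (x / (2 * N)))\<^sup>2 * (1 - (delta N lam)\<^sup>2) < (delta N lam)\<^sup>2}"

text \<open>
  The null set excluded throughout: the pole of \<open>g_map \<circ> f_map N\<close> (where \<open>tan\<close> is a junk value) and the
  two preimages of the base point of the slit.
\<close>

definition slit_except :: "real \<Rightarrow> real \<Rightarrow> real set" where
  "slit_except N lam = {x. cos (x / (2 * N)) = 0 \<or>
     (tan (x / (2 * N)))\<^sup>2 * (1 - (delta N lam)\<^sup>2) = (delta N lam)\<^sup>2}"

text \<open>The boundary value of \<open>phi\<close> at \<open>g_map (f_map N x) = tan (x / (2 N))\<close>, for \<open>x\<close> off the arc.\<close>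

definition slit_tan :: "real \<Rightarrow> real \<Rightarrow> real \<Rightarrow> real" where
  "slit_tan N lam x = sgn (tan (x / (2 * N))) *
     sqrt ((tan (x / (2 * N)))\<^sup>2 * (1 - (delta N lam)\<^sup>2) - (delta N lam)\<^sup>2)"

text \<open>The way back from \<open>slit_tan\<close> to the cylinder. The scaled
  \<open>arctan\<close> lies in (- pi N, pi N), and the shift moves its negative values to the
  representatives that \<open>f_inv\<close> selects. On the arc the root has a negative argument,
  and the value has no geometric meaning there.\<close>

definition slit_real :: "real \<Rightarrow> real \<Rightarrow> real \<Rightarrow> real" where
  "slit_real N lam x = 2 * N * arctan (slit_tan N lam x) + (if slit_tan N lam x < 0 then 2 * pi * N else 0)"

lemma delta_bounds:
  assumes "N > 0" "lam > 0"
  shows "0 < delta N lam" "delta N lam < 1"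
  using assms by (auto simp: delta_def field_simps add_pos_pos)

section \<open>The coordinate changes and their inverses\<close>

lemma norm_f_map: "norm (f_map N z) = exp (Im z / N)"
  by (simp add: f_map_def Re_divide_of_real)

lemma f_map_add_period:
  assumes "N > 0"
  shows "f_map N (z + of_real (2 * pi * N * of_int j)) = f_map N z"
proof -
  have "- \<i> * (z + of_real (2 * pi * N * of_int j)) / of_real N
      = - \<i> * z / of_real N + of_int (2 * (- j)) * of_real pi * \<i>"
    using assms by (simp add: field_simps)
  then show ?thesis
    unfolding f_map_def exp_eq by (intro exI[of _ "- j"]) simp
qed

lemma f_inv_f_map:
  assumes N: "N > 0" and "0 \<le> Im z" "0 \<le> Re z" "Re z < 2 * pi * N"
  shows "f_inv N (f_map N z) = z"
proof -
  have "inj_on (f_map N) {z. 0 \<le> Im z \<and> 0 \<le> Re z \<and> Re z < 2 * pi * N}"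
  proof (rule inj_onI, clarify)
    fix z w assume *: "0 \<le> Re z" "Re z < 2 * pi * N" "0 \<le> Re w" "Re w < 2 * pi * N"
      and eq: "f_map N z = f_map N w"
    have "- \<i> * z / of_real N = - \<i> * w / of_real N"
    proof (rule exp_complex_eqI)
      have "\<bar>Re w / N - Re z / N\<bar> = \<bar>Re w - Re z\<bar> / N"
        using N by (simp add: diff_divide_distrib[symmetric])
      also have "\<dots> < 2 * pi"
        using * N by (simp add: field_simps abs_less_iff)
      finally show "\<bar>Im (- \<i> * z / of_real N) - Im (- \<i> * w / of_real N)\<bar> < 2 * pi"
        by (simp add: Im_divide_of_real)
      show "exp (- \<i> * z / of_real N) = exp (- \<i> * w / of_real N)"
        using eq by (simp add: f_map_def)
    qed
    then show "z = w" using N by simp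
  qed
  then show ?thesis
    unfolding f_inv_def by (rule the_inv_into_f_f) (use assms in auto)
qed

text \<open>An explicit preimage identifies the value of \<open>f_inv\<close>: the principal
  logarithm gives a real part in [- pi N, pi N), and one period is added when it is
  negative.\<close>

lemma f_inv_props:
  assumes N: "N > 0" and v: "norm v \<ge> 1"
  shows "f_map N (f_inv N v) = v" "Im (f_inv N v) = N * ln (norm v)"
proof -
  have v0: "v \<noteq> 0" using v by auto
  define w where "w = \<i> * of_real N * Ln v"
  define w' where "w' = w + of_real (2 * pi * N * of_int (if Re w < 0 then 1 else 0))"
  have Rew: "Re w = - (N * Im (Ln v))" and Imw: "Im w = N * ln (norm v)"
    using v0 by (simp_all add: w_def)
  have fw: "f_map N w = v" using N v0 by (simp add: f_map_def w_def field_simps)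
  have fw': "f_map N w' = v"
    unfolding w'_def f_map_add_period[OF N] by (rule fw)
  have "- (pi * N) \<le> Re w" "Re w < pi * N"
    using mpi_less_Im_Ln[OF v0] Im_Ln_le_pi[OF v0] N
    by (auto simp: Rew field_simps mult_less_cancel_left_pos)
      (smt (verit) mult_less_cancel_left_pos mult.commute mult_minus_right)+
  moreover have "pi * N > 0" using N by simp
  ultimately have "0 \<le> Re w'" "Re w' < 2 * pi * N"
    unfolding w'_def by auto
  moreover have Imw': "Im w' = N * ln (norm v)" by (simp add: w'_def Imw)
  moreover have "0 \<le> N * ln (norm v)" using N v by simp
  ultimately have "f_inv N v = w'"
    using f_inv_f_map[OF N, of w'] fw' by simp
  then show "f_map N (f_inv N v) = v" "Im (f_inv N v) = N * ln (norm v)"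
    using fw' Imw' by auto
qed

lemma g_map_cayley:
  assumes "u \<noteq> \<i>"
  shows "g_map (cayley u) = u"
proof -
  have nz: "\<i> - u \<noteq> 0" using assms by simp
  have "cayley u - 1 = 2 * u / (\<i> - u)" "cayley u + 1 = 2 * \<i> / (\<i> - u)"
    using nz by (simp_all add: cayley_def field_simps)
  then show ?thesis using nz by (simp add: g_map_def)
qed

lemma cayley_g_map: "z \<noteq> -1 \<Longrightarrow> cayley (g_map z) = z"
proof -
  assume "z \<noteq> -1"
  then have nz: "z + 1 \<noteq> 0" by (simp add: add_eq_0_iff2)
  have "\<i> + g_map z = 2 * \<i> * z / (z + 1)" "\<i> - g_map z = 2 * \<i> / (z + 1)"
    using nz by (simp_all add: g_map_def field_simps)
  then show ?thesis using nz by (simp add: cayley_def)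
qed

text \<open>A point of the upper half-plane is closer to \<i> than to - \<i>. The point \<i> itself
  is the pole of \<open>cayley\<close>, where division by zero would return 0.\<close>

lemma norm_cayley_gt:
  assumes "Im u > 0" "u \<noteq> \<i>"
  shows "norm (cayley u) > 1"
proof -
  have "(norm (\<i> - u))\<^sup>2 < (norm (\<i> + u))\<^sup>2"
    using assms unfolding cmod_power2 by (simp add: power2_eq_square algebra_simps)
  then have "norm (\<i> - u) < norm (\<i> + u)"
    using power2_less_imp_less by fastforce
  then show ?thesis using assms by (simp add: cayley_def norm_divide)
qed

lemma g_inv_eq:
  assumes "Im u > 0" "u \<noteq> \<i>"
  shows "g_inv u = cayley u"
proof -
  have "inj_on g_map {z. norm z > 1}"
  proof (rule inj_on_inverseI)
    fix z :: complex assume "z \<in> {z. norm z > 1}"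
    then have "z \<noteq> -1" by auto
    then show "cayley (g_map z) = z" by (rule cayley_g_map)
  qed
  from the_inv_into_f_f[OF this, of "cayley u"] show ?thesis
    using norm_cayley_gt[OF assms] g_map_cayley[OF assms(2)] by (simp add: g_inv_def)
qed

text \<open>Expanding the fraction by the conjugate of z + 1 gives the imaginary part (|z|^2 - 1) /
  |z + 1|^2.\<close>

lemma Im_g_map:
  assumes "norm z > 1"
  shows "Im (g_map z) > 0"
proof -
  have nz: "z + 1 \<noteq> 0" using assms by (metis add_eq_0_iff norm_minus_cancel norm_one less_irrefl)
  have "g_map z = \<i> * ((z - 1) * cnj (z + 1)) / of_real ((norm (z + 1))\<^sup>2)"
  proof -
    have "cnj (z + 1) \<noteq> 0" using nz by (simp only: complex_cnj_zero_iff) simp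
    then show ?thesis
      unfolding g_map_def complex_norm_square
      by (metis (no_types, lifting) mult.assoc mult_divide_mult_cancel_right)
  qed
  then have "Im (g_map z) = Re ((z - 1) * cnj (z + 1)) / (norm (z + 1))\<^sup>2"
    by (simp only: Im_divide_of_real) simp
  also have "Re ((z - 1) * cnj (z + 1)) = (norm z)\<^sup>2 - 1"
    unfolding cmod_power2 by (simp add: power2_eq_square algebra_simps)
  finally show ?thesis using assms nz by (simp add: one_less_power)
qed

section \<open>The slit map in the open upper half-plane\<close>

lemma phi_power2: "(phi a z)\<^sup>2 = z\<^sup>2 * (1 - (of_real a)\<^sup>2) - (of_real a)\<^sup>2"
  by (simp add: phi_def power_mult_distrib)

text \<open>Both claims exclude real values r \<ge> - a^2 of the radicand: such a value would make
  z^2 a nonnegative real, impossible for Im z > 0. With r \<ge> 0 the root would be real, and r = -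
  s^2 with s \<le> a would put it on the slit.\<close>

lemma phi_upper_half_plane:
  assumes z: "Im z > 0" and a: "0 < a" "a < 1"
  shows "Im (phi a z) > 0" and "\<And>s. 0 \<le> s \<Longrightarrow> s \<le> a \<Longrightarrow> phi a z \<noteq> \<i> * of_real s"
proof -
  have a2: "1 - a\<^sup>2 > 0" using a by (simp add: power_less_one_iff)
  have key: "z\<^sup>2 * (1 - (of_real a)\<^sup>2) - (of_real a)\<^sup>2 \<noteq> of_real r" if r: "r \<ge> - a\<^sup>2" for r
  proof
    assume *: "z\<^sup>2 * (1 - (of_real a)\<^sup>2) - (of_real a)\<^sup>2 = of_real r"
    have "z\<^sup>2 * of_real (1 - a\<^sup>2) = of_real (r + a\<^sup>2)" using * by (simp add: algebra_simps)
    then have e: "z\<^sup>2 = of_real ((r + a\<^sup>2) / (1 - a\<^sup>2))" using a2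
      by (metis nonzero_eq_divide_eq of_real_divide of_real_eq_0_iff less_irrefl)
    then have "Im (z\<^sup>2) = 0" and "Re (z\<^sup>2) = (r + a\<^sup>2) / (1 - a\<^sup>2)" by simp_all
    then have "Re z = 0" and "(Re z)\<^sup>2 - (Im z)\<^sup>2 = (r + a\<^sup>2) / (1 - a\<^sup>2)"
      using z by (simp_all add: power2_eq_square)
    moreover have "(r + a\<^sup>2) / (1 - a\<^sup>2) \<ge> 0" using r a2 by simp
    moreover have "(Im z)\<^sup>2 > 0" using z by simp
    ultimately show False by simp
  qed
  define w where "w = - (z\<^sup>2 * (1 - (of_real a)\<^sup>2) - (of_real a)\<^sup>2)"
  have phi: "phi a z = \<i> * csqrt w" by (simp add: phi_def w_def)
  have "Re (csqrt w) \<noteq> 0"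
  proof
    assume "Re (csqrt w) = 0"
    then have "csqrt w = \<i> * of_real (Im (csqrt w))" by (simp add: complex_eq_iff)
    then have "(csqrt w)\<^sup>2 = - of_real ((Im (csqrt w))\<^sup>2)"
      by (metis i_squared mult_minus1 of_real_power power2_eq_square power_mult_distrib)
    then have "- w = of_real ((Im (csqrt w))\<^sup>2)"
      unfolding power2_csqrt by (metis minus_minus)
    then have "z\<^sup>2 * (1 - (of_real a)\<^sup>2) - (of_real a)\<^sup>2 = of_real ((Im (csqrt w))\<^sup>2)"
      by (simp only: w_def minus_minus)
    moreover have "(Im (csqrt w))\<^sup>2 \<ge> - a\<^sup>2"
      by (rule order_trans[of _ 0]) simp_all
    ultimately show False using key by blast
  qed
  then show "Im (phi a z) > 0"
    using csqrt_principal[of w] by (auto simp: phi)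
  fix s assume s: "0 \<le> s" "s \<le> a"
  show "phi a z \<noteq> \<i> * of_real s"
  proof
    assume "phi a z = \<i> * of_real s"
    then have "(phi a z)\<^sup>2 = of_real (- (s\<^sup>2))" by (simp add: power_mult_distrib)
    moreover have "- (s\<^sup>2) \<ge> - (a\<^sup>2)" using s by (simp add: power_mono)
    ultimately show False using key phi_power2 by metis
  qed
qed

text \<open>\<open>delta N lam\<close> is tanh (lam / (2 N)): the point \<i> s of the cylinder is
  sent to exp (s / N) and then to \<i> tanh (s / (2 N)), which increases with s. So the slit of
  height lam goes into the segment from 0 to \<i> \<open>delta N lam\<close> that \<open>phi\<close>
  avoids.\<close>

lemma cayley_slit_value:
  assumes "N > 0" "lam > 0" "0 \<le> s" "s \<le> lam"
  shows "\<exists>s'. 0 \<le> s' \<and> s' \<le> delta N lam \<and> g_map (of_real (exp (s / N))) = \<i> * of_real s'"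
proof (intro exI conjI)
  let ?e = "exp (s / N)"
  have e: "?e \<ge> 1" "?e \<le> exp (lam / N)" using assms by (auto simp: divide_right_mono)
  show "0 \<le> (?e - 1) / (?e + 1)" using e by simp
  show "(?e - 1) / (?e + 1) \<le> delta N lam"
  proof -
    have "(?e - 1) / (?e + 1) = 1 - 2 / (?e + 1)" proof -
      have "?e + 1 \<noteq> 0" using e(1) by linarith
      then show ?thesis by (simp add: divide_simps)
    qed
    also have "\<dots> \<le> delta N lam" unfolding delta_def using e by (intro diff_left_mono divide_left_mono) (auto intro!: mult_pos_pos add_pos_pos)
    finally show ?thesis .
  qed
  show "g_map (of_real ?e) = \<i> * of_real ((?e - 1) / (?e + 1))"
    by (simp add: g_map_def)
qed

text \<open>The identity is stated after applying \<open>f_map N\<close>, which removes the jumps by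
  a period in the values of \<open>slit_map_open\<close>. Avoidance of the slit is inherited from
  \<open>phi\<close>: a representative of a slit point would come from the excluded segment.\<close>

lemma slit_map_open_f_map:
  assumes N: "N > 0" and lam: "lam > 0" and z: "Im z > 0"
  shows "f_map N (slit_map_open N lam z) = cayley (phi (delta N lam) (g_map (f_map N z)))"
    and "Im (slit_map_open N lam z) > 0"
    and "slit_map_open N lam z \<notin> cyl_slit N lam 0"
proof -
  let ?a = "delta N lam"
  note a = delta_bounds[OF N lam]
  define u where "u = phi ?a (g_map (f_map N z))"
  have G: "Im (g_map (f_map N z)) > 0"
    using N z by (intro Im_g_map) (simp add: norm_f_map)
  have u: "Im u > 0" unfolding u_def by (rule phi_upper_half_plane(1)[OF G a])
  have us: "u \<noteq> \<i> * of_real s" if "0 \<le> s" "s \<le> ?a" for s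
    unfolding u_def by (rule phi_upper_half_plane(2)[OF G a that])
  \<comment> \<open>Only \<i> can be sent to \<i> by \<open>phi\<close>, and \<open>g_map\<close>
    would take the value \<i> only at infinity: with w = \<open>f_map N z\<close> it would require w
    - 1 = w + 1.\<close>
  have "u \<noteq> \<i>"
  proof
    assume "u = \<i>"
    then have "u\<^sup>2 = -1" by simp
    then have "(g_map (f_map N z))\<^sup>2 * (1 - (of_real ?a)\<^sup>2) = - of_real (1 - ?a\<^sup>2)"
      unfolding u_def phi_power2 by (simp add: algebra_simps)
    then have "((g_map (f_map N z))\<^sup>2 + 1) * of_real (1 - ?a\<^sup>2) = 0"
      by (simp only: of_real_diff of_real_power of_real_1 distrib_right mult_1 add_eq_0_iff2)
    moreover have "1 - ?a\<^sup>2 \<noteq> 0" using a by (simp add: power2_eq_1_iff)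
    ultimately have "(g_map (f_map N z))\<^sup>2 = - 1"
      by (metis add_eq_0_iff2 mult_eq_0_iff of_real_eq_0_iff)
    then have gi: "g_map (f_map N z) = \<i>"
      using G by (metis i_squared power2_eq_iff power2_i not_less_iff_gr_or_eq complex.sel(2) imaginary_unit.sel(2) less_minus_iff minus_zero uminus_complex.sel(2) zero_less_one)
    have "f_map N z + 1 \<noteq> 0" 
      using norm_f_map[of N z] N z by (metis add_eq_0_iff norm_minus_cancel norm_one less_irrefl divide_pos_pos one_less_exp_iff)
    then show False using gi by (simp add: g_map_def field_simps)
  qed
  then have gi: "g_inv u = cayley u" and nc: "norm (cayley u) > 1"
    using g_inv_eq norm_cayley_gt u by auto
  have S: "slit_map_open N lam z = f_inv N (cayley u)"
    using gi by (simp add: slit_map_open_def u_def)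
  show f: "f_map N (slit_map_open N lam z) = cayley (phi ?a (g_map (f_map N z)))"
    unfolding S using f_inv_props(1)[OF N] nc by (simp add: u_def)
  show "Im (slit_map_open N lam z) > 0"
    unfolding S f_inv_props(2)[OF N less_imp_le[OF nc]] using nc N by (simp add: ln_gt_zero)
  show "slit_map_open N lam z \<notin> cyl_slit N lam 0"
  proof
    assume "slit_map_open N lam z \<in> cyl_slit N lam 0"
    then obtain j :: int and s where s: "0 \<le> s" "s \<le> lam"
      and eq: "slit_map_open N lam z = Complex (2 * pi * N * of_int j) s"
      by (auto simp: cyl_slit_def)
    have "Complex (2 * pi * N * of_int j) s = \<i> * of_real s + of_real (2 * pi * N * of_int j)"
      by (simp add: complex_eq_iff)
    then have "f_map N (slit_map_open N lam z) = f_map N (\<i> * of_real s)"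
      using f_map_add_period[OF N] eq by simp
    also have "\<dots> = of_real (exp (s / N))"
      by (simp add: f_map_def exp_of_real flip: of_real_divide)
    finally have "cayley u = of_real (exp (s / N))" using f by (simp add: u_def)
    then have "u = g_map (of_real (exp (s / N)))"
      using g_map_cayley[OF \<open>u \<noteq> \<i>\<close>] by simp
    with cayley_slit_value[OF N lam s] us show False by metis
  qed
qed

section \<open>Boundary values of the slit map\<close>

text \<open>The half-angle identity exp (- \<i> x / N) = cis (- t) / cis t with t = x / (2 N);
  dividing numerator and denominator by cos t produces the tangent.\<close>

lemma f_map_arctan:
  assumes "N > 0" "cos (x / (2 * N)) \<noteq> 0"
  shows "f_map N (of_real x) = cayley (of_real (tan (x / (2 * N))))"
proof -
  let ?t = "x / (2 * N)"
  have "f_map N (of_real x) = cis (- ?t) * cis (- ?t)"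
  proof -
    have "- (x / N) = - ?t + - ?t" by simp
    then have "cis (- ?t) * cis (- ?t) = cis (- (x / N))" by (simp only: cis_mult)
    then show ?thesis by (simp add: f_map_def cis_conv_exp)
  qed
  moreover have "cis (- ?t) / cis ?t = cis (- ?t) * cis (- ?t)"
    by (simp add: cis_divide cis_mult)
  moreover have "cayley (of_real (tan ?t)) = cis (- ?t) / cis ?t"
  proof -
    have 1: "\<i> + of_real (tan ?t) = \<i> * cis (- ?t) / of_real (cos ?t)"
      using assms by (auto simp: complex_eq_iff tan_def Re_divide_of_real Im_divide_of_real)
    have 2: "\<i> - of_real (tan ?t) = \<i> * cis ?t / of_real (cos ?t)"
      using assms by (auto simp: complex_eq_iff tan_def Re_divide_of_real Im_divide_of_real)
    have "of_real (cos ?t) \<noteq> (0::complex)" using assms by simp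
    then show ?thesis unfolding cayley_def 1 2 by simp
  qed
  ultimately show ?thesis by simp
qed

text \<open>If the radicand has a negative limit, the argument of \<open>csqrt\<close> tends to a
  positive real, where \<open>csqrt\<close> is continuous. If the limit is positive, that argument
  tends to a point of the branch cut and the side of approach matters: the imaginary part of the
  radicand has the sign of Re (G w), hence eventually that of u.\<close>

lemma tendsto_phi_real:
  fixes G :: "'b \<Rightarrow> complex" and u :: real
  assumes G: "(G \<longlongrightarrow> of_real u) F" and Im: "\<forall>\<^sub>F w in F. Im (G w) > 0" and a: "0 < a" "a < 1"
  shows "u\<^sup>2 * (1 - a\<^sup>2) < a\<^sup>2 \<Longrightarrow>
      ((\<lambda>w. phi a (G w)) \<longlongrightarrow> \<i> * of_real (sqrt (a\<^sup>2 - u\<^sup>2 * (1 - a\<^sup>2)))) F"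
    and "a\<^sup>2 < u\<^sup>2 * (1 - a\<^sup>2) \<Longrightarrow>
      ((\<lambda>w. phi a (G w)) \<longlongrightarrow> of_real (sgn u * sqrt (u\<^sup>2 * (1 - a\<^sup>2) - a\<^sup>2))) F"
proof -
  let ?P = "\<lambda>z. z\<^sup>2 * (1 - (of_real a)\<^sup>2) - (of_real a)\<^sup>2 :: complex"
  have P: "((\<lambda>w. ?P (G w)) \<longlongrightarrow> of_real (u\<^sup>2 * (1 - a\<^sup>2) - a\<^sup>2)) F"
    using tendsto_diff[OF tendsto_mult[OF tendsto_power[OF G, of 2] tendsto_const] tendsto_const, of "1 - (of_real a)\<^sup>2" "(of_real a)\<^sup>2"]
    by simp
  {
    assume lt: "u\<^sup>2 * (1 - a\<^sup>2) < a\<^sup>2"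
    have "((\<lambda>w. - ?P (G w)) \<longlongrightarrow> of_real (a\<^sup>2 - u\<^sup>2 * (1 - a\<^sup>2))) F"
      using tendsto_minus[OF P] by simp
    then have "((\<lambda>w. csqrt (- ?P (G w))) \<longlongrightarrow> csqrt (of_real (a\<^sup>2 - u\<^sup>2 * (1 - a\<^sup>2)))) F"
      by (intro isCont_tendsto_compose[OF continuous_at_csqrt]) (use lt in \<open>simp_all only: complex_nonpos_Reals_iff, simp_all\<close>)
    then have "((\<lambda>w. \<i> * csqrt (- ?P (G w))) \<longlongrightarrow> \<i> * csqrt (of_real (a\<^sup>2 - u\<^sup>2 * (1 - a\<^sup>2)))) F"
      by (intro tendsto_intros)
    then show "((\<lambda>w. phi a (G w)) \<longlongrightarrow> \<i> * of_real (sqrt (a\<^sup>2 - u\<^sup>2 * (1 - a\<^sup>2)))) F"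
      using lt by (simp add: phi_def csqrt_of_real_nonneg del: of_real_diff of_real_mult of_real_power)
  next
    assume lt: "a\<^sup>2 < u\<^sup>2 * (1 - a\<^sup>2)"
    have a2: "1 - a\<^sup>2 > 0" using a by (simp add: power_less_one_iff)
    have u0: "u \<noteq> 0" using lt by (auto simp: not_less)
    \<comment> \<open>Negating the argument moves the limit off the cut; \<open>csqrt_minus\<close>
      then restores \<open>phi\<close>, at the price of the factor sgn u.\<close>
    have "((\<lambda>w. csqrt (?P (G w))) \<longlongrightarrow> csqrt (of_real (u\<^sup>2 * (1 - a\<^sup>2) - a\<^sup>2))) F"
      by (intro isCont_tendsto_compose[OF continuous_at_csqrt] P) (use lt in \<open>simp_all only: complex_nonpos_Reals_iff, simp_all\<close>)
    then have lim: "((\<lambda>w. of_real (sgn u) * csqrt (?P (G w))) \<longlongrightarrow> of_real (sgn u) * of_real (sqrt (u\<^sup>2 * (1 - a\<^sup>2) - a\<^sup>2))) F"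
      using lt by (intro tendsto_intros) (simp add: csqrt_of_real_nonneg del: of_real_diff of_real_mult of_real_power)
    have "((\<lambda>w. sgn u * Re (G w)) \<longlongrightarrow> sgn u * u) F"
      using tendsto_Re[OF G] by (intro tendsto_intros) simp
    moreover have "sgn u * u > 0" using u0 by (simp add: sgn_mult_self_eq abs_sgn[symmetric] mult.commute)
    ultimately have "\<forall>\<^sub>F w in F. sgn u * Re (G w) > 0"
      by (rule order_tendstoD)
    with Im have "\<forall>\<^sub>F w in F. of_real (sgn u) * csqrt (?P (G w)) = phi a (G w)"
    proof eventually_elim
      case (elim w)
      have ImP: "Im (?P (G w)) = 2 * Re (G w) * Im (G w) * (1 - a\<^sup>2)"
      proof -
        have "?P (G w) = (G w)\<^sup>2 * of_real (1 - a\<^sup>2) - of_real (a\<^sup>2)" by simp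
        then show ?thesis by (simp only: minus_complex.sel Im_complex_of_real) (simp add: power2_eq_square)
      qed
      show ?case
      proof (cases "u > 0")
        case True
        then have "Re (G w) > 0" using elim by simp
        then have "Im (- ?P (G w)) < 0" using ImP elim a2 by simp
        then have "csqrt (- (- ?P (G w))) = \<i> * csqrt (- ?P (G w))"
          by (intro csqrt_minus) auto
        then show ?thesis using True by (simp add: phi_def)
      next
        case False
        then have "u < 0" using u0 by simp
        then have "Re (G w) < 0" using elim by simp
        then have "Im (?P (G w)) < 0" using ImP elim a2 by (simp add: mult_neg_pos)
        then have "csqrt (- ?P (G w)) = \<i> * csqrt (?P (G w))"
          by (intro csqrt_minus) auto
        then show ?thesis using \<open>u < 0\<close> by (simp add: phi_def)
      qed
    qed
    with lim show "((\<lambda>w. phi a (G w)) \<longlongrightarrow> of_real (sgn u * sqrt (u\<^sup>2 * (1 - a\<^sup>2) - a\<^sup>2))) F"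
      by (simp add: tendsto_cong)
  }
qed

lemma at_within_upper_half_plane: "Im z = 0 \<Longrightarrow> at z within {w. Im w > 0} \<noteq> bot"
proof -
  assume z: "Im z = 0"
  have "z islimpt {w. Im w > 0}"
    unfolding islimpt_approachable
  proof (intro allI impI)
    fix e :: real assume "e > 0"
    then show "\<exists>x'\<in>{w. 0 < Im w}. x' \<noteq> z \<and> dist x' z < e"
      using z by (intro bexI[of _ "z + \<i> * of_real (e / 2)"]) (auto simp: dist_norm norm_mult)
  qed
  then show ?thesis by (simp add: trivial_limit_within)
qed

text \<open>The cases on and off the arc differ only in the limit of \<open>phi\<close>. The
  hypothesis \<open>lim\<close> isolates that limit for an arbitrary filter, so that the surrounding
  continuity argument is shared. The condition t \<noteq> \<i> keeps away from the pole of
  \<open>cayley\<close>.\<close>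

lemma slit_map0_boundary:
  assumes N: "N > 0" and lam: "lam > 0" and c: "cos (x / (2 * N)) \<noteq> 0"
    and lim: "\<And>F G. \<lbrakk>(G \<longlongrightarrow> of_real (tan (x / (2 * N)))) F; \<forall>\<^sub>F w in F. Im (G w) > 0\<rbrakk> \<Longrightarrow>
       ((\<lambda>w :: complex. phi (delta N lam) (G w)) \<longlongrightarrow> t) F"
    and t: "t \<noteq> \<i>"
  shows "slit_map0 N lam (of_real x) = f_inv N (cayley t)"
proof -
  let ?F = "at (of_real x :: complex) within {w. Im w > 0}"
  let ?u = "of_real (tan (x / (2 * N))) :: complex"
  have fx: "f_map N (of_real x) = cayley ?u"
    by (rule f_map_arctan[OF N c])
  have ui: "?u \<noteq> \<i>" by (simp add: complex_eq_iff)
  have ne: "f_map N (of_real x) + 1 \<noteq> 0"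
    unfolding fx cayley_def using ui by (simp add: field_simps)
  have "((\<lambda>w. f_map N w) \<longlongrightarrow> f_map N (of_real x)) ?F"
    unfolding f_map_def using N by (intro tendsto_intros) auto
  then have "((\<lambda>w. g_map (f_map N w)) \<longlongrightarrow> g_map (f_map N (of_real x))) ?F"
    unfolding g_map_def using ne by (intro tendsto_intros) auto
  then have "((\<lambda>w. g_map (f_map N w)) \<longlongrightarrow> ?u) ?F"
    using fx g_map_cayley[OF ui] by simp
  moreover have ev: "\<forall>\<^sub>F w in ?F. Im w > 0"
    by (auto simp: eventually_at_filter)
  moreover have "\<forall>\<^sub>F w in ?F. Im (g_map (f_map N w)) > 0"
    using ev by eventually_elim (use N in \<open>auto intro!: Im_g_map simp: norm_f_map\<close>)
  ultimately have "((\<lambda>w. phi (delta N lam) (g_map (f_map N w))) \<longlongrightarrow> t) ?F"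
    by (intro lim)
  then have "((\<lambda>w. cayley (phi (delta N lam) (g_map (f_map N w)))) \<longlongrightarrow> cayley t) ?F"
    unfolding cayley_def using t by (intro tendsto_intros) auto
  moreover have "\<forall>\<^sub>F w in ?F. cayley (phi (delta N lam) (g_map (f_map N w))) = f_map N (slit_map_open N lam w)"
    using ev by eventually_elim (simp add: slit_map_open_f_map(1)[OF N lam])
  ultimately have "((\<lambda>w. f_map N (slit_map_open N lam w)) \<longlongrightarrow> cayley t) ?F"
    by (simp add: tendsto_cong)
  then show ?thesis
    using at_within_upper_half_plane[of "of_real x"]
    by (simp add: slit_map0_def tendsto_Lim)
qed

lemma slit_map0_arc:
  assumes N: "N > 0" and lam: "lam > 0" and x: "x \<notin> slit_except N lam" "x \<in> slit_arc N lam"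
  shows "Im (slit_map0 N lam (of_real x)) > 0" "slit_map0 N lam (of_real x) \<in> cyl_slit N lam 0"
proof -
  let ?a = "delta N lam" and ?u = "tan (x / (2 * N))"
  note a = delta_bounds[OF N lam]
  have c: "cos (x / (2 * N)) \<noteq> 0" and lt: "?u\<^sup>2 * (1 - ?a\<^sup>2) < ?a\<^sup>2"
    using x by (auto simp: slit_except_def slit_arc_def)
  define s where "s = sqrt (?a\<^sup>2 - ?u\<^sup>2 * (1 - ?a\<^sup>2))"
  have a2: "1 - ?a\<^sup>2 > 0" using a by (simp add: power_less_one_iff)
  have s: "0 < s" using lt by (simp add: s_def)
  have "s \<le> sqrt (?a\<^sup>2)" unfolding s_def using a2 by (intro real_sqrt_le_mono) simp
  then have sa: "s \<le> ?a" using a by simp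
  have S: "slit_map0 N lam (of_real x) = f_inv N (cayley (\<i> * of_real s))"
  proof (rule slit_map0_boundary[OF N lam c])
    show "\<i> * of_real s \<noteq> \<i>" using sa a by (simp add: complex_eq_iff)
  qed (use tendsto_phi_real(1)[OF _ _ a lt] in \<open>simp add: s_def\<close>)
  \<comment> \<open>\<open>cayley\<close> sends \<i> s to r, and \<open>f_map N\<close> sends the
    point of height N ln r above 0 to r as well, so N ln r is the height reached on the slit. At s =
    \<open>delta N lam\<close> the value of r is exp (lam / N), which corresponds to the tip of
    height lam.\<close>
  define r where "r = (1 + s) / (1 - s)"
  have r: "r > 1" using s sa a by (simp add: r_def field_simps)
  have "r \<le> (1 + ?a) / (1 - ?a)" unfolding r_def using s sa a by (intro frac_le) auto
  also have "\<dots> = exp (lam / N)"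
  proof -
    have "exp (lam / N) + 1 \<noteq> 0" by (metis exp_gt_zero add_pos_pos zero_less_one less_irrefl)
    then show ?thesis unfolding delta_def by (simp add: field_simps)
  qed
  finally have rl: "ln r \<le> lam / N" using r by (metis ln_ge_iff exp_le_cancel_iff exp_ln less_trans zero_less_one)
  have "cayley (\<i> * of_real s) = of_real r"
  proof -
    have "\<i> + \<i> * of_real s = \<i> * of_real (1 + s)" "\<i> - \<i> * of_real s = \<i> * of_real (1 - s)"
      by (simp_all add: algebra_simps)
    then show ?thesis unfolding cayley_def r_def by simp
  qed
  also have "\<dots> = f_map N (\<i> * of_real (N * ln r))"
    using N r by (simp add: f_map_def exp_of_real flip: of_real_mult of_real_divide)
  finally have cy: "cayley (\<i> * of_real s) = f_map N (\<i> * of_real (N * ln r))" .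
  have S': "slit_map0 N lam (of_real x) = \<i> * of_real (N * ln r)"
    unfolding S cy using N r by (intro f_inv_f_map) auto
  show "Im (slit_map0 N lam (of_real x)) > 0" using N r by (simp add: S')
  have "slit_map0 N lam (of_real x) = Complex (0 + 2 * pi * N * of_int 0) (N * ln r)"
    by (simp add: S' complex_eq_iff)
  moreover have "0 \<le> N * ln r" "N * ln r \<le> lam" using N r rl by (auto simp: field_simps)
  ultimately show "slit_map0 N lam (of_real x) \<in> cyl_slit N lam 0"
    unfolding cyl_slit_def by blast
qed

lemma slit_map0_off_arc:
  assumes N: "N > 0" and lam: "lam > 0" and x: "x \<notin> slit_except N lam" "x \<notin> slit_arc N lam"
  shows "slit_map0 N lam (of_real x) = of_real (slit_real N lam x)"
    "slit_map0 N lam (of_real x) \<notin> cyl_slit N lam 0"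
proof -
  let ?a = "delta N lam" and ?u = "tan (x / (2 * N))"
  note a = delta_bounds[OF N lam]
  have c: "cos (x / (2 * N)) \<noteq> 0" and lt: "?a\<^sup>2 < ?u\<^sup>2 * (1 - ?a\<^sup>2)"
    using x by (auto simp: slit_except_def slit_arc_def)
  define t where "t = slit_tan N lam x"
  have u0: "?u \<noteq> 0" using lt by (auto simp: not_less)
  have t0: "t \<noteq> 0" using lt u0 unfolding t_def slit_tan_def mult_eq_0_iff sgn_zero_iff real_sqrt_eq_zero_cancel_iff by linarith
  have S: "slit_map0 N lam (of_real x) = f_inv N (cayley (of_real t))"
  proof (rule slit_map0_boundary[OF N lam c])
    show "of_real t \<noteq> \<i>" by (simp add: complex_eq_iff)
  qed (use tendsto_phi_real(2)[OF _ _ a lt] in \<open>simp add: t_def slit_tan_def\<close>)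
  let ?y = "2 * N * arctan t"
  have y2: "?y / (2 * N) = arctan t" using N by simp
  have "cayley (of_real t) = f_map N (of_real ?y)"
    using f_map_arctan[OF N, of ?y] by (simp only: y2 tan_arctan) simp
  also have "\<dots> = f_map N (of_real (slit_real N lam x))"
    using f_map_add_period[OF N, of "of_real ?y" 1] by (simp add: slit_real_def t_def)
  finally have cy: "cayley (of_real t) = f_map N (of_real (slit_real N lam x))" .
  \<comment> \<open>The bounds are strict because t is nonzero. They keep the image away from the
    multiples of 2 pi N, which are the only real points of \<open>cyl_slit N lam 0\<close>.\<close>
  have b: "0 < slit_real N lam x \<and> slit_real N lam x < 2 * pi * N"
  proof (cases "t < 0")
    case True
    have "arctan t < 0" "- (pi / 2) < arctan t" using True arctan_lbound[of t] by auto
    have "N * arctan t < 0" using N \<open>arctan t < 0\<close> by (rule mult_pos_neg)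
    moreover have "N * - (pi / 2) < N * arctan t"
      using \<open>- (pi / 2) < arctan t\<close> N by (rule mult_strict_left_mono)
    ultimately show ?thesis using True mult_pos_pos[OF N pi_gt_zero] unfolding slit_real_def t_def[symmetric] by (simp add: mult.assoc mult.commute[of pi])
  next
    case False
    then have "arctan t > 0" "arctan t < pi / 2" using t0 arctan_ubound[of t] by auto
    then have "0 < N * arctan t" "N * arctan t < N * (pi / 2)" using N by simp_all
    then show ?thesis using False mult_pos_pos[OF N pi_gt_zero] unfolding slit_real_def t_def[symmetric] by (simp add: mult.assoc mult.commute[of pi])
  qed
  show eq: "slit_map0 N lam (of_real x) = of_real (slit_real N lam x)"
    unfolding S cy by (rule f_inv_f_map[OF N]) (use b in simp_all)
  show "slit_map0 N lam (of_real x) \<notin> cyl_slit N lam 0"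
  proof
    assume "slit_map0 N lam (of_real x) \<in> cyl_slit N lam 0"
    then obtain j :: int where "slit_real N lam x = 2 * pi * N * of_int j"
      unfolding eq cyl_slit_def by (auto simp: complex_eq_iff)
    then have "0 < (2 * pi * N) * real_of_int j" "(2 * pi * N) * real_of_int j < (2 * pi * N) * 1"
      using b by simp_all
    moreover have "2 * pi * N > 0" using N by simp
    ultimately have "0 < real_of_int j" "real_of_int j < 1"
      by (blast dest: zero_less_mult_pos, metis mult_less_cancel_left_pos)
    then show False by simp
  qed
qed

section \<open>Composition of slit maps\<close>

text \<open>The recursion of \<open>slit_comp\<close> with an arbitrary real map \<sigma> in place
  of the slit map. It runs on through hits of the arc, where it stops following the slit maps; being
  total, it allows the law of the offsets to be found for any measurable \<sigma>. The map centred
  at x i meets the offset \<open>back_orbit \<sigma> x (Suc i) m - x i\<close>.\<close>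

definition back_orbit :: "(real \<Rightarrow> real) \<Rightarrow> (nat \<Rightarrow> real) \<Rightarrow> nat \<Rightarrow> nat \<Rightarrow> real" where
  "back_orbit \<sigma> x j m = foldr (\<lambda>i y. x i + \<sigma> (y - x i)) [j..<m] (x m)"

lemma back_orbit_self [simp]: "back_orbit \<sigma> x m m = x m"
  by (simp add: back_orbit_def)

lemma back_orbit_rec:
  "j < m \<Longrightarrow> back_orbit \<sigma> x j m = x j + \<sigma> (back_orbit \<sigma> x (Suc j) m - x j)"
  by (simp add: back_orbit_def upt_conv_Cons)

lemma back_orbit_cong:
  assumes "j \<le> m" "\<And>i. j \<le> i \<Longrightarrow> i \<le> m \<Longrightarrow> x i = y i"
  shows "back_orbit \<sigma> x j m = back_orbit \<sigma> y j m"
  unfolding back_orbit_def using assms by (auto intro!: foldr_cong)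

lemma slit_comp_rec:
  "j < m \<Longrightarrow> slit_comp N lam x j m z = slit_map N lam (x j) (slit_comp N lam x (Suc j) m z)"
  by (simp add: slit_comp_def upt_conv_Cons)

lemma slit_map_in_cyl_slit:
  "slit_map N lam x z \<in> cyl_slit N lam x \<longleftrightarrow> slit_map0 N lam (z - of_real x) \<in> cyl_slit N lam 0"
  unfolding slit_map_def cyl_slit_def mem_Collect_eq by (simp add: complex_eq_iff add.assoc)

context
  fixes N lam :: real
  assumes N: "N > 0" and lam: "lam > 0"
begin

lemma slit_map_upper:
  assumes "Im z > 0"
  shows "Im (slit_map N lam x z) > 0" "slit_map N lam x z \<notin> cyl_slit N lam x"
  using slit_map_open_f_map(2,3)[OF N lam, of "z - of_real x"] assms
  by (auto simp: slit_map_in_cyl_slit) (simp_all add: slit_map_def slit_map0_def)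

lemma slit_comp_real:
  assumes "j \<le> m"
    and "\<forall>i\<in>{j..<m}. back_orbit (slit_real N lam) x (Suc i) m - x i \<notin> slit_except N lam \<union> slit_arc N lam"
  shows "slit_comp N lam x j m (of_real (x m)) = of_real (back_orbit (slit_real N lam) x j m)"
  using assms
proof (induction rule: inc_induct)
  case base
  then show ?case by (simp add: slit_comp_def)
next
  case (step n)
  then have "slit_comp N lam x (Suc n) m (of_real (x m)) = of_real (back_orbit (slit_real N lam) x (Suc n) m)"
    by auto
  then show ?case
    using step slit_map0_off_arc(1)[OF N lam, of "back_orbit (slit_real N lam) x (Suc n) m - x n"]
    by (simp add: slit_comp_rec back_orbit_rec slit_map_def)
qed

text \<open>The maps act in the order of decreasing index, so the first hit occurs at the largest
  index whose offset is in the arc. Until then the orbit is the real one, the hit lifts the point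
  off the boundary, and \<open>slit_map_upper\<close> keeps it off.\<close>

lemma slit_comp_upper:
  assumes "j \<le> m"
    and "\<forall>i\<in>{j..<m}. back_orbit (slit_real N lam) x (Suc i) m - x i \<notin> slit_except N lam"
    and "\<exists>i\<in>{j..<m}. back_orbit (slit_real N lam) x (Suc i) m - x i \<in> slit_arc N lam"
  shows "Im (slit_comp N lam x j m (of_real (x m))) > 0"
  using assms
proof (induction rule: inc_induct)
  case base
  then show ?case by simp
next
  case (step n)
  show ?case
  proof (cases "\<exists>i\<in>{Suc n..<m}. back_orbit (slit_real N lam) x (Suc i) m - x i \<in> slit_arc N lam")
    case True
    with step show ?thesis by (auto simp: slit_comp_rec intro!: slit_map_upper)
  next
    case False
    then have "slit_comp N lam x (Suc n) m (of_real (x m)) = of_real (back_orbit (slit_real N lam) x (Suc n) m)"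
      using step by (intro slit_comp_real) auto
    moreover have "back_orbit (slit_real N lam) x (Suc n) m - x n \<in> slit_arc N lam"
      using False step.prems(2) by (metis atLeastLessThan_iff le_antisym not_less_eq_eq)
    ultimately show ?thesis
      using step slit_map0_arc(1)[OF N lam, of "back_orbit (slit_real N lam) x (Suc n) m - x n"]
      by (simp add: slit_comp_rec slit_map_def)
  qed
qed

text \<open>Splitting off the index k separates the map that has to hit from those that must not.
  The right-hand side prescribes one set per offset, the form in which independence yields a
  product.\<close>

lemma directly_attached_iff:
  assumes km: "k < m"
    and ne: "\<forall>i\<in>{k..<m}. back_orbit (slit_real N lam) x (Suc i) m - x i \<notin> slit_except N lam"
  shows "directly_attached N lam x m k \<longleftrightarrow>
    (\<forall>i\<in>{k..<m}. back_orbit (slit_real N lam) x (Suc i) m - x i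
        \<in> (if i = k then slit_arc N lam else - slit_arc N lam))"
proof -
  let ?d = "\<lambda>i. back_orbit (slit_real N lam) x (Suc i) m - x i"
  have rhs: "(\<forall>i\<in>{k..<m}. ?d i \<in> (if i = k then slit_arc N lam else - slit_arc N lam)) \<longleftrightarrow>
      ?d k \<in> slit_arc N lam \<and> (\<forall>i\<in>{Suc k..<m}. ?d i \<notin> slit_arc N lam)"
    using km by (auto simp: Suc_le_eq)
  have lhs: "directly_attached N lam x m k \<longleftrightarrow>
      slit_map N lam (x k) (slit_comp N lam x (Suc k) m (of_real (x m))) \<in> cyl_slit N lam (x k)"
    using km by (simp add: directly_attached_def slit_comp_rec)
  show ?thesis
  proof (cases "\<exists>i\<in>{Suc k..<m}. ?d i \<in> slit_arc N lam")
    case True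
    then have "Im (slit_comp N lam x (Suc k) m (of_real (x m))) > 0"
      using km ne by (intro slit_comp_upper) auto
    from slit_map_upper(2)[OF this] show ?thesis
      unfolding lhs rhs using True by blast
  next
    case False
    then have "slit_comp N lam x (Suc k) m (of_real (x m)) = of_real (back_orbit (slit_real N lam) x (Suc k) m)"
      using km ne by (intro slit_comp_real) auto
    then have "directly_attached N lam x m k \<longleftrightarrow> slit_map0 N lam (of_real (?d k)) \<in> cyl_slit N lam 0"
      unfolding lhs slit_map_in_cyl_slit by simp
    also have "\<dots> \<longleftrightarrow> ?d k \<in> slit_arc N lam"
      using slit_map0_arc(2)[OF N lam, of "?d k"] slit_map0_off_arc(2)[OF N lam, of "?d k"] ne km
      by auto
    finally show ?thesis unfolding rhs using False by blast
  qed
qed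

section \<open>Measurability, periodicity and size of the arc and the exceptional set\<close>

lemma borel_measurable_tan [measurable]: "(tan :: real \<Rightarrow> real) \<in> borel_measurable borel"
  unfolding tan_def[abs_def] by measurable

lemma borel_measurable_arctan [measurable]: "arctan \<in> borel_measurable borel"
  by (intro borel_measurable_continuous_onI continuous_intros)

lemma slit_real_measurable [measurable]: "slit_real N lam \<in> borel_measurable borel"
  unfolding slit_real_def[abs_def] slit_tan_def by measurable

lemma slit_arc_sets [measurable]: "slit_arc N lam \<in> sets borel"
  unfolding slit_arc_def by measurable

lemma slit_except_sets [measurable]: "slit_except N lam \<in> sets borel"
  unfolding slit_except_def by measurable

text \<open>Moving x by 2 pi N moves the half-angle by pi, which is a period of the tangent and only
  changes the sign of the cosine.\<close>

lemma slit_periodic: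
  shows "x + 2 * pi * N \<in> slit_arc N lam \<longleftrightarrow> x \<in> slit_arc N lam"
    and "x + 2 * pi * N \<in> slit_except N lam \<longleftrightarrow> x \<in> slit_except N lam"
proof -
  have "(x + 2 * pi * N) / (2 * N) = x / (2 * N) + pi" using N by (simp add: field_simps)
  then show "x + 2 * pi * N \<in> slit_arc N lam \<longleftrightarrow> x \<in> slit_arc N lam"
    and "x + 2 * pi * N \<in> slit_except N lam \<longleftrightarrow> x \<in> slit_except N lam"
    by (simp_all add: slit_arc_def slit_except_def)
qed

text \<open>By 1 + tan^2 = 1 / cos^2, the cosine of the half-angle of an exceptional point is 0 or
  plus or minus sqrt (1 - delta^2). Over one fundamental domain the half-angle stays in [0, pi),
  where the cosine is injective.\<close>

lemma finite_slit_except: "finite (slit_except N lam \<inter> {0..<2 * pi * N})"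
proof -
  let ?c = "sqrt (1 - (delta N lam)\<^sup>2)"
  note a = delta_bounds[OF N lam]
  have a2: "1 - (delta N lam)\<^sup>2 > 0" using a by (simp add: power_less_one_iff)
  have "inj_on (\<lambda>x. cos (x / (2 * N))) {0..<2 * pi * N}"
  proof (rule inj_onI)
    fix x y assume x: "x \<in> {0..<2 * pi * N}" and y: "y \<in> {0..<2 * pi * N}"
      and eq: "cos (x / (2 * N)) = cos (y / (2 * N))"
    have "0 \<le> z / (2 * N) \<and> z / (2 * N) \<le> pi" if "z \<in> {0..<2 * pi * N}" for z
      using that N by (simp add: divide_le_eq mult_ac)
    with x y eq have "x / (2 * N) = y / (2 * N)"
      by (blast intro: cos_inj_pi)
    then show "x = y" using N by simp
  qed
  then have "finite ((\<lambda>x. cos (x / (2 * N))) -` {0, ?c, - ?c} \<inter> {0..<2 * pi * N})"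
    by (intro finite_vimage_IntI) auto
  moreover have "slit_except N lam \<subseteq> (\<lambda>x. cos (x / (2 * N))) -` {0, ?c, - ?c}"
  proof
    fix x assume x: "x \<in> slit_except N lam"
    show "x \<in> (\<lambda>x. cos (x / (2 * N))) -` {0, ?c, - ?c}"
    proof (cases "cos (x / (2 * N)) = 0")
      case False
      let ?t = "x / (2 * N)"
      have "(tan ?t)\<^sup>2 * (1 - (delta N lam)\<^sup>2) = (delta N lam)\<^sup>2"
        using x False by (auto simp: slit_except_def)
      then have "(1 + (tan ?t)\<^sup>2) * (1 - (delta N lam)\<^sup>2) = 1" by (simp add: algebra_simps)
      then have "inverse (cos ?t) ^ 2 * (1 - (delta N lam)\<^sup>2) = 1"
        using tan_sec[OF False] by simp
      then have "(cos ?t)\<^sup>2 = 1 - (delta N lam)\<^sup>2"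
        using False by (simp add: inverse_eq_divide power_divide divide_eq_eq)
      also have "\<dots> = ?c\<^sup>2" using a2 by simp
      finally show ?thesis by (auto simp: power2_eq_iff)
    qed simp
  qed
  ultimately show ?thesis by (auto elim: finite_subset[rotated])
qed

text \<open>The expression that defines the arc vanishes at x = 0 and is continuous there, so the
  arc contains a right neighbourhood of 0. Positivity makes the ratio of the geometric series
  smaller than 1.\<close>

lemma emeasure_slit_arc_pos: "emeasure lborel (slit_arc N lam \<inter> {0..<2 * pi * N}) > 0"
proof -
  note a = delta_bounds[OF N lam]
  let ?f = "\<lambda>x. (tan (x / (2 * N)))\<^sup>2 * (1 - (delta N lam)\<^sup>2)"
  have "((\<lambda>x. tan (x / (2 * N))) \<longlongrightarrow> tan (0 / (2 * N))) (nhds 0)"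
    by (intro tendsto_tan tendsto_divide filterlim_ident tendsto_const) (use N in auto)
  then have "(?f \<longlongrightarrow> (tan (0 / (2 * N)))\<^sup>2 * (1 - (delta N lam)\<^sup>2)) (nhds 0)"
    by (intro tendsto_mult tendsto_power tendsto_const)
  then have "\<forall>\<^sub>F x in nhds 0. ?f x < (delta N lam)\<^sup>2"
    by (rule order_tendstoD) (use a in simp)
  then obtain d where d: "d > 0" "\<And>x. dist x 0 < d \<Longrightarrow> ?f x < (delta N lam)\<^sup>2"
    by (auto simp: eventually_nhds_metric)
  let ?e = "min d (2 * pi * N)"
  have e: "?e > 0" using d N by simp
  have "ennreal ?e = emeasure lborel {0..<?e}" using e by simp
  also have "\<dots> \<le> emeasure lborel (slit_arc N lam \<inter> {0..<2 * pi * N})"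
    using d by (intro emeasure_mono) (auto simp: slit_arc_def dist_real_def)
  finally show ?thesis
    using e by (meson ennreal_less_zero_iff less_le_trans)
qed

end

section \<open>The uniform law on the circle and the law of the offsets\<close>

definition uniform_circle :: "real \<Rightarrow> real measure" where
  "uniform_circle L = uniform_measure lborel {0..<L}"

lemma sets_uniform_circle [simp, measurable_cong]: "sets (uniform_circle L) = sets borel"
  by (simp add: uniform_circle_def)

lemma space_uniform_circle [simp]: "space (uniform_circle L) = UNIV"
  by (simp add: uniform_circle_def)

lemma prob_space_uniform_circle: "L > 0 \<Longrightarrow> prob_space (uniform_circle L)"
  unfolding uniform_circle_def by (rule prob_space_uniform_measure) auto

lemma emeasure_uniform_circle:
  "L > 0 \<Longrightarrow> A \<in> sets borel \<Longrightarrow>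
    emeasure (uniform_circle L) A = emeasure lborel (A \<inter> {0..<L}) / ennreal L"
  by (simp add: uniform_circle_def Int_commute)

lemma emeasure_lborel_reflect:
  fixes c :: real
  assumes [measurable]: "A \<in> sets borel"
  shows "emeasure lborel {y. c - y \<in> A} = emeasure lborel A"
proof -
  have "emeasure lborel A = (\<integral>\<^sup>+ y. indicator A y \<partial>lborel)" by simp
  also have "\<dots> = (\<integral>\<^sup>+ y. indicator A (c + (- 1) * y) \<partial>lborel)"
    by (subst nn_integral_real_affine[where c = "- 1" and t = c]) auto
  also have "\<dots> = (\<integral>\<^sup>+ y. indicator {y. c - y \<in> A} y \<partial>lborel)"
    by (intro nn_integral_cong) (simp add: indicator_def)
  also have "\<dots> = emeasure lborel {y. c - y \<in> A}" by simp
  finally show ?thesis by simp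
qed

lemma periodic_int:
  fixes L :: real
  assumes "\<And>x. x + L \<in> J \<longleftrightarrow> x \<in> J"
  shows "x + of_int n * L \<in> J \<longleftrightarrow> x \<in> J"
proof (induction n arbitrary: x rule: int_induct[where k = 0])
  case (step1 i)
  have "x + of_int (i + 1) * L = (x + of_int i * L) + L" by (simp add: algebra_simps)
  then show ?case using assms step1 by metis
next
  case (step2 i)
  have "(x + of_int (i - 1) * L) + L = x + of_int i * L" by (simp add: algebra_simps)
  then show ?case using assms step2 by metis
qed simp

text \<open>Let r be z reduced modulo L. Subtraction from r maps [0, r] to itself, and subtraction
  from r + L maps (r, L) to itself; periodicity of J lets the two reflections be used side by
  side.\<close>

lemma uniform_circle_reflect:
  assumes L: "L > 0" and J [measurable]: "J \<in> sets borel" and per: "\<And>x. x + L \<in> J \<longleftrightarrow> x \<in> J"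
  shows "emeasure (uniform_circle L) {y. z - y \<in> J} = emeasure (uniform_circle L) J"
proof -
  define n where "n = \<lfloor>z / L\<rfloor>"
  define r where "r = z - of_int n * L"
  have r: "0 \<le> r" "r < L"
    using floor_divide_lower[OF L, of z] floor_divide_upper[OF L, of z]
    by (simp_all add: r_def n_def algebra_simps)
  have zr: "z - y \<in> J \<longleftrightarrow> r - y \<in> J" for y
    using periodic_int[of L J "r - y" n, OF per] by (simp add: r_def algebra_simps)
  have "{y. z - y \<in> J} \<inter> {0..<L} =
      {y. r - y \<in> J \<inter> {0..r}} \<union> {y. (r + L) - y \<in> J \<inter> {r<..<L}}"
  proof -
    have "(r + L) - y \<in> J \<longleftrightarrow> r - y \<in> J" for y
      using per[of "r - y"] by (simp add: algebra_simps)
    then show ?thesis using r by (auto simp: zr)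
  qed
  also have "emeasure lborel \<dots> = emeasure lborel {y. r - y \<in> J \<inter> {0..r}} + emeasure lborel {y. (r + L) - y \<in> J \<inter> {r<..<L}}"
    by (intro plus_emeasure[symmetric]) auto
  also have "\<dots> = emeasure lborel (J \<inter> {0..r}) + emeasure lborel (J \<inter> {r<..<L})"
    by (intro arg_cong2[where f = "(+)"] emeasure_lborel_reflect) measurable
  also have "\<dots> = emeasure lborel ((J \<inter> {0..r}) \<union> (J \<inter> {r<..<L}))"
    by (intro plus_emeasure) auto
  also have "(J \<inter> {0..r}) \<union> (J \<inter> {r<..<L}) = J \<inter> {0..<L}" using r by auto
  finally show ?thesis by (simp add: emeasure_uniform_circle L)
qed

lemma coordinate_measurable:
  assumes "i \<in> I"
  shows "(\<lambda>x. x i) \<in> borel_measurable (PiM I (\<lambda>_. uniform_circle L))"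
  using measurable_component_singleton[OF assms, of "\<lambda>_. uniform_circle L"]
  by (simp add: measurable_cong_sets[OF refl sets_uniform_circle])

lemma back_orbit_measurable [measurable]:
  assumes [measurable]: "\<sigma> \<in> borel_measurable borel" and "k \<le> j" "j \<le> m"
  shows "(\<lambda>x. back_orbit \<sigma> x j m) \<in> borel_measurable (PiM {k..m} (\<lambda>_. uniform_circle L))"
  using assms(3,2)
proof (induction rule: inc_induct)
  case base
  then show ?case by (simp add: coordinate_measurable)
next
  case (step n)
  then have [measurable]: "(\<lambda>x. back_orbit \<sigma> x (Suc n) m) \<in> borel_measurable (PiM {k..m} (\<lambda>_. uniform_circle L))"
    by simp
  have [measurable]: "(\<lambda>x. x n) \<in> borel_measurable (PiM {k..m} (\<lambda>_. uniform_circle L))"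
    using step by (intro coordinate_measurable) auto
  show ?case using step by (simp add: back_orbit_rec)
qed

lemma offsets_sets:
  assumes [measurable]: "\<sigma> \<in> borel_measurable borel" and [measurable]: "\<And>i. J i \<in> sets borel"
  shows "{x \<in> space (PiM {k..m} (\<lambda>_. uniform_circle L)). \<forall>i\<in>{k..<m}. back_orbit \<sigma> x (Suc i) m - x i \<in> J i}
    \<in> sets (PiM {k..m} (\<lambda>_. uniform_circle L))"
proof (rule sets.sets_Collect_finite_All)
  fix i assume "i \<in> {k..<m}"
  then have [measurable]: "(\<lambda>x. back_orbit \<sigma> x (Suc i) m) \<in> borel_measurable (PiM {k..m} (\<lambda>_. uniform_circle L))"
    "(\<lambda>x. x i) \<in> borel_measurable (PiM {k..m} (\<lambda>_. uniform_circle L))"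
    by (auto intro!: back_orbit_measurable coordinate_measurable)
  show "{x \<in> space (PiM {k..m} (\<lambda>_. uniform_circle L)). back_orbit \<sigma> x (Suc i) m - x i \<in> J i}
    \<in> sets (PiM {k..m} (\<lambda>_. uniform_circle L))"
    by measurable
qed simp

text \<open>Given the later points, \<open>x j\<close> is uniform on the circle, so the offset is uniform whatever the later points are.\<close>

lemma emeasure_offsets:
  assumes L: "L > 0" and [measurable]: "\<sigma> \<in> borel_measurable borel"
    and J [measurable]: "\<And>i. J i \<in> sets borel" and per: "\<And>i x. x + L \<in> J i \<longleftrightarrow> x \<in> J i"
    and "k \<le> m"
  shows "emeasure (PiM {k..m} (\<lambda>_. uniform_circle L))
      {x \<in> space (PiM {k..m} (\<lambda>_. uniform_circle L)). \<forall>i\<in>{k..<m}. back_orbit \<sigma> x (Suc i) m - x i \<in> J i}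
    = (\<Prod>i\<in>{k..<m}. emeasure (uniform_circle L) (J i))"
  using \<open>k \<le> m\<close>
proof (induction rule: inc_induct)
  case base
  interpret prob_space "PiM {m..m} (\<lambda>_. uniform_circle L)"
    by (intro prob_space_PiM prob_space_uniform_circle L)
  show ?case using emeasure_space_1 by simp
next
  case (step n)
  let ?U = "uniform_circle L" and ?P = "\<lambda>n. PiM {n..m} (\<lambda>_. uniform_circle L)"
  let ?E = "\<lambda>n x. \<forall>i\<in>{n..<m}. back_orbit \<sigma> x (Suc i) m - x i \<in> J i"
  interpret U: prob_space ?U by (intro prob_space_uniform_circle L)
  interpret product_sigma_finite "\<lambda>_::nat. ?U" by standard
  have ins: "{n..m} = insert n {Suc n..m}" "{n..<m} = insert n {Suc n..<m}" using step by auto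
  have [measurable]: "{x \<in> space (?P l). ?E l x} \<in> sets (?P l)" for l
    by (rule offsets_sets) measurable
  \<comment> \<open>The pulled-back points that occur here depend on coordinates above n only, so
    the coordinate n enters just the offset at n, as the subtracted centre.\<close>
  have split: "?E n (x(n := y)) \<longleftrightarrow> ?E (Suc n) x \<and> back_orbit \<sigma> x (Suc n) m - y \<in> J n" for x y
  proof -
    have "back_orbit \<sigma> (x(n := y)) (Suc i) m = back_orbit \<sigma> x (Suc i) m" if "i \<in> {n..<m}" for i
      using that by (intro back_orbit_cong) auto
    then show ?thesis unfolding ins by auto
  qed
  have "emeasure (?P n) {x \<in> space (?P n). ?E n x} = (\<integral>\<^sup>+ x. indicator {x \<in> space (?P n). ?E n x} x \<partial>?P n)"
    by simp
  also have "\<dots> = (\<integral>\<^sup>+ x. (\<integral>\<^sup>+ y. indicator {x \<in> space (?P n). ?E n x} (x(n := y)) \<partial>?U) \<partial>?P (Suc n))"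
    unfolding ins(1) by (rule product_nn_integral_insert) (simp_all flip: ins(1))
  also have "\<dots> = (\<integral>\<^sup>+ x. indicator {x \<in> space (?P (Suc n)). ?E (Suc n) x} x * emeasure ?U (J n) \<partial>?P (Suc n))"
  proof (rule nn_integral_cong)
    fix x assume x: "x \<in> space (?P (Suc n))"
    have "x(n := y) \<in> space (?P n)" for y
      using x unfolding ins(1) by (auto simp: space_PiM PiE_def extensional_def)
    then have "(\<integral>\<^sup>+ y. indicator {x \<in> space (?P n). ?E n x} (x(n := y)) \<partial>?U)
       = (\<integral>\<^sup>+ y. indicator {x \<in> space (?P (Suc n)). ?E (Suc n) x} x * indicator {y. back_orbit \<sigma> x (Suc n) m - y \<in> J n} y \<partial>?U)"
      using x by (intro nn_integral_cong) (simp only: indicator_def mem_Collect_eq split, simp)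
    also have "\<dots> = indicator {x \<in> space (?P (Suc n)). ?E (Suc n) x} x * emeasure ?U {y. back_orbit \<sigma> x (Suc n) m - y \<in> J n}"
      by (subst nn_integral_cmult) auto
    also have "emeasure ?U {y. back_orbit \<sigma> x (Suc n) m - y \<in> J n} = emeasure ?U (J n)"
      by (rule uniform_circle_reflect[OF L J per])
    finally show "(\<integral>\<^sup>+ y. indicator {x \<in> space (?P n). ?E n x} (x(n := y)) \<partial>?U) =
      indicator {x \<in> space (?P (Suc n)). ?E (Suc n) x} x * emeasure ?U (J n)" .
  qed
  also have "\<dots> = emeasure (?P (Suc n)) {x \<in> space (?P (Suc n)). ?E (Suc n) x} * emeasure ?U (J n)"
    by (subst nn_integral_multc) auto
  also have "\<dots> = (\<Prod>i\<in>{n..<m}. emeasure ?U (J i))"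
    using step.IH unfolding ins(2) by (simp add: mult.commute)
  finally show ?case .
qed

section \<open>Counts of the Poisson process\<close>

lemma increasing_from:
  fixes T :: "nat \<Rightarrow> 'a :: order"
  assumes T_Suc: "\<And>n. n \<ge> k \<Longrightarrow> T n < T (Suc n)" and "k \<le> a" "a < b"
  shows "T a < T b"
  using assms(3,2)
proof (induction rule: strict_inc_induct)
  case (base i)
  then show ?case using T_Suc by simp
next
  case (step i)
  then have "T i < T (Suc i)" "T (Suc i) < T b" using T_Suc by simp_all
  then show ?case by (rule less_trans)
qed

text \<open>The Poisson hypothesis speaks of counts in fixed sets, whereas the centres are indexed
  by time order. Because the cells are themselves ordered in time, one point per box and none
  elsewhere before K determine the indices. The cell i belongs to the index Suc i because the points
  are numbered from 1.\<close>

lemma points_in_cells_iff: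
  fixes T X :: "nat \<Rightarrow> real" and A B :: "nat \<Rightarrow> real set"
  defines "P \<equiv> {(T n, X n) | n. n \<ge> 1}"
  assumes T1: "0 < T 1" and T_Suc: "\<And>n. n \<ge> 1 \<Longrightarrow> T n < T (Suc n)"
    and X: "\<And>n. n \<ge> 1 \<Longrightarrow> X n \<in> Y"
    and fin: "finite (P \<inter> {0..<K} \<times> Y)"
    and A: "\<And>i. i < m \<Longrightarrow> A i \<subseteq> {0..<K}"
    and less: "\<And>i j s t. i < j \<Longrightarrow> j < m \<Longrightarrow> s \<in> A i \<Longrightarrow> t \<in> A j \<Longrightarrow> s < t"
  shows "(\<forall>i<m. T (Suc i) \<in> A i \<and> X (Suc i) \<in> B i) \<and> K \<le> T (Suc m) \<longleftrightarrow>
    (\<forall>i<m. card (P \<inter> A i \<times> B i) = 1) \<and> card (P \<inter> ({0..<K} \<times> Y - (\<Union>i<m. A i \<times> B i))) = 0"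
    (is "?lhs \<longleftrightarrow> ?rhs")
proof
  have T_less: "T a < T b" if "1 \<le> a" "a < b" for a b
    using increasing_from[of 1 T, OF T_Suc] that by blast
  have T_less_iff: "T a < T b \<longleftrightarrow> a < b" if "1 \<le> a" "1 \<le> b" for a b
    using T_less that by (metis less_asym linorder_neqE_nat less_irrefl)
  have T_pos: "0 < T n" if "n \<ge> 1" for n
    using T1 T_less[of 1 n] that by (cases "n = 1") auto
  let ?V = "{0..<K} \<times> Y - (\<Union>i<m. A i \<times> B i)"
  have disj: "i = j" if "i < m" "j < m" "t \<in> A i" "t \<in> A j" for i j t
    using less that by (metis less_irrefl linorder_neqE_nat)
  {
    assume lhs: ?lhs
    have early: "\<exists>i<m. n = Suc i" if "n \<ge> 1" "T n < K" for n
    proof -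
      have "T n < T (Suc m)" using that lhs by linarith
      then have "n < Suc m" using T_less_iff that by auto
      then show ?thesis using that by (cases n) auto
    qed
    have "P \<inter> A i \<times> B i = {(T (Suc i), X (Suc i))}" if i: "i < m" for i
    proof
      show "P \<inter> A i \<times> B i \<subseteq> {(T (Suc i), X (Suc i))}"
      proof
        fix p assume "p \<in> P \<inter> A i \<times> B i"
        then obtain n where n: "n \<ge> 1" "p = (T n, X n)" "T n \<in> A i" by (auto simp: P_def)
        with A[OF i] early obtain i' where i': "i' < m" "n = Suc i'" by fastforce
        with lhs disj n i have "i' = i" by metis
        with n i' show "p \<in> {(T (Suc i), X (Suc i))}" by simp
      qed
      show "{(T (Suc i), X (Suc i))} \<subseteq> P \<inter> A i \<times> B i"
        using lhs i by (auto simp: P_def)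
    qed
    moreover have "P \<inter> ?V = {}"
      using early lhs by (fastforce simp: P_def)
    ultimately show ?rhs by simp
  next
    assume rhs: ?rhs
    \<comment> \<open>\<open>card\<close> is 0 for infinite sets too; finiteness turns the count 0
      into emptiness.\<close>
    have "finite (P \<inter> ?V)" by (rule finite_subset[OF _ fin]) auto
    with rhs have V: "P \<inter> ?V = {}" by simp
    have "\<forall>i\<in>{..<m}. \<exists>n. n \<ge> 1 \<and> P \<inter> A i \<times> B i = {(T n, X n)}"
    proof
      fix i assume "i \<in> {..<m}"
      with rhs have "card (P \<inter> A i \<times> B i) = 1" by simp
      then obtain p where p: "P \<inter> A i \<times> B i = {p}" by (rule card_1_singletonE)
      then have "p \<in> P" by blast
      with p show "\<exists>n. n \<ge> 1 \<and> P \<inter> A i \<times> B i = {(T n, X n)}" by (auto simp: P_def)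
    qed
    from bchoice[OF this] obtain n where
      n: "\<And>i. i < m \<Longrightarrow> n i \<ge> 1" "\<And>i. i < m \<Longrightarrow> P \<inter> A i \<times> B i = {(T (n i), X (n i))}" by auto
    have nAB: "T (n i) \<in> A i" "X (n i) \<in> B i" if "i < m" for i
      using n(2)[OF that] by blast+
    have early: "\<exists>i<m. q = n i" if q: "q \<ge> 1" "T q < K" for q
    proof -
      have "(T q, X q) \<in> P \<inter> {0..<K} \<times> Y"
        using q X T_pos[of q] by (auto simp: P_def)
      with V obtain i where i: "i < m" "(T q, X q) \<in> P \<inter> A i \<times> B i" by blast
      then have "T q = T (n i)" using n(2) by auto
      then show ?thesis using T_less_iff[of q "n i"] T_less_iff[of "n i" q] q n(1) i
        by (metis less_irrefl linorder_neqE_nat)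
    qed
    have n_less: "n i < n j" if "i < j" "j < m" for i j
      using less[OF that nAB(1) nAB(1)] T_less_iff n(1) that by simp
    \<comment> \<open>The selected indices increase and exhaust the points before K. If n i exceeded
      Suc i, the earlier point Suc i would have to be selected by some cell j, and each position of
      j relative to i is contradictory. If n i were too small, it would repeat the index of an
      earlier cell.\<close>
    have n_eq: "n i = Suc i" if "i < m" for i
      using that
    proof (induction i rule: less_induct)
      case (less i)
      show ?case
      proof (rule ccontr)
        assume ne: "n i \<noteq> Suc i"
        have "\<not> n i < Suc i"
        proof
          assume "n i < Suc i"
          then have "n i - 1 < i" using n(1)[of i] less.prems by auto
          then have "n (n i - 1) = Suc (n i - 1)" using less by simp
          moreover have "n (n i - 1) < n i" using n_less \<open>n i - 1 < i\<close> less.prems by simp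
          ultimately show False by simp
        qed
        with ne have lt: "Suc i < n i" by simp
        then have "T (Suc i) < T (n i)" by (intro T_less) auto
        also have "T (n i) < K" using nAB(1) A less.prems by fastforce
        finally obtain j where j: "j < m" "Suc i = n j" using early[of "Suc i"] by auto
        show False
          using j lt less.IH[of j] n_less[of i j] less.prems by (cases i j rule: linorder_cases) auto
      qed
    qed
    have "K \<le> T (Suc m)"
      using early[of "Suc m"] n_eq by (force simp: not_less[symmetric])
    with nAB n_eq show ?lhs by simp
  }
qed

section \<open>Almost sure properties and joint counts of the driving process\<close>

locale chl_process =
  fixes M :: "'w measure" and N :: real and T X :: "nat \<Rightarrow> 'w \<Rightarrow> real"
  assumes N: "N > 0" and driving: "chl_driving M N T X"
begin

abbreviation "L \<equiv> 2 * pi * N"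

abbreviation points :: "'w \<Rightarrow> (real \<times> real) set" where
  "points \<omega> \<equiv> {(T n \<omega>, X n \<omega>) | n. n \<ge> 1}"

lemma L_pos: "L > 0" using N by simp

lemma poisson: "poisson_point_process M (chl_intensity N) points"
  using driving by (simp add: chl_driving_def)

sublocale prob_space M
  using poisson by (simp add: poisson_point_process_def)

lemma T_measurable [measurable]: "T (Suc n) \<in> borel_measurable M"
  and X_measurable [measurable]: "X (Suc n) \<in> borel_measurable M"
  using driving by (auto simp: chl_driving_def)

lemma chl_intensity_sets_iff: "A \<in> sets (chl_intensity N) \<longleftrightarrow> A \<in> sets borel \<and> A \<subseteq> {0..} \<times> {0..<L}"
proof -
  have "{0..} \<times> {0..<L} \<in> sets (lborel :: (real \<times> real) measure)"
    by (simp add: borel_prod[symmetric])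
  then show ?thesis
    unfolding chl_intensity_def by (subst sets_restrict_space_iff) auto
qed

lemma emeasure_chl_intensity:
  "A \<subseteq> {0..} \<times> {0..<L} \<Longrightarrow> emeasure (chl_intensity N) A = emeasure lborel A"
  unfolding chl_intensity_def
  by (rule emeasure_restrict_space) (auto simp: borel_prod[symmetric])

lemma chl_intensity_Times:
  assumes "A \<in> sets borel" "B \<in> sets borel" "A \<subseteq> {0..}" "B \<subseteq> {0..<L}"
  shows "A \<times> B \<in> sets (chl_intensity N)"
    and "emeasure (chl_intensity N) (A \<times> B) = emeasure lborel A * emeasure lborel B"
proof -
  show "A \<times> B \<in> sets (chl_intensity N)"
    using assms by (auto simp: chl_intensity_sets_iff borel_prod[symmetric])
  have "emeasure (chl_intensity N) (A \<times> B) = emeasure (lborel \<Otimes>\<^sub>M lborel) (A \<times> B)"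
    using assms by (subst emeasure_chl_intensity) (auto simp: lborel_prod)
  also have "\<dots> = emeasure lborel A * emeasure lborel B"
    using assms by (intro lborel.emeasure_pair_measure_Times) auto
  finally show "emeasure (chl_intensity N) (A \<times> B) = emeasure lborel A * emeasure lborel B" .
qed

text \<open>Finiteness is obtained for natural K, where a countable union of null sets is discarded,
  and passes to real K by inclusion of boxes.\<close>

lemma AE_good:
  "AE \<omega> in M. 0 < T 1 \<omega> \<and> (\<forall>n\<ge>1. T n \<omega> < T (Suc n) \<omega>) \<and> (\<forall>n\<ge>1. X n \<omega> \<in> {0..<L}) \<and>
     (\<forall>K. finite (points \<omega> \<inter> {0..<K} \<times> {0..<L}))"
proof -
  have 1: "AE \<omega> in M. 0 < T 1 \<omega> \<and> (\<forall>n\<ge>1. T n \<omega> < T (Suc n) \<omega>)"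
    using driving by (simp add: chl_driving_def)
  have "AE \<omega> in M. points \<omega> \<subseteq> space (chl_intensity N)"
    using poisson by (simp add: poisson_point_process_def)
  moreover have "space (chl_intensity N) = {0..} \<times> {0..<L}"
    by (simp add: chl_intensity_def space_restrict_space)
  ultimately have "AE \<omega> in M. points \<omega> \<subseteq> {0..} \<times> {0..<L}" by (simp only:)
  then have 2: "AE \<omega> in M. \<forall>n\<ge>1. X n \<omega> \<in> {0..<L}" by eventually_elim blast
  have "AE \<omega> in M. finite (points \<omega> \<inter> {0..<real K} \<times> {0..<L})" for K :: nat
  proof -
    have "{0..<real K} \<times> {0..<L} \<in> sets (chl_intensity N)"
      "emeasure (chl_intensity N) ({0..<real K} \<times> {0..<L}) < \<infinity>"
      using chl_intensity_Times[of "{0..<real K}" "{0..<L}"] L_pos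
      by (auto simp: ennreal_mult_less_top subset_iff)
    then show ?thesis using poisson by (auto simp: poisson_point_process_def)
  qed
  then have "AE \<omega> in M. \<forall>K :: nat. finite (points \<omega> \<inter> {0..<real K} \<times> {0..<L})"
    by (simp add: AE_all_countable)
  then have 3: "AE \<omega> in M. \<forall>K. finite (points \<omega> \<inter> {0..<K} \<times> {0..<L})"
  proof eventually_elim
    case (elim \<omega>)
    show ?case
    proof
      fix K :: real
      obtain n :: nat where "K \<le> real n" using real_arch_simple by blast
      then have "points \<omega> \<inter> {0..<K} \<times> {0..<L} \<subseteq> points \<omega> \<inter> {0..<real n} \<times> {0..<L}" by auto
      then show "finite (points \<omega> \<inter> {0..<K} \<times> {0..<L})" using elim by (blast intro: finite_subset)
    qed
  qed
  from 1 2 3 show ?thesis by eventually_elim auto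
qed

lemma prob_counts:
  fixes r :: nat and C :: "nat \<Rightarrow> (real \<times> real) set" and c :: "nat \<Rightarrow> nat"
  assumes "\<And>i. i < r \<Longrightarrow> C i \<in> sets (chl_intensity N)"
    and "\<And>i. i < r \<Longrightarrow> emeasure (chl_intensity N) (C i) < \<infinity>"
    and "disjoint_family_on C {..<r}" "r > 0"
  shows "prob {\<omega> \<in> space M. \<forall>i<r. card (points \<omega> \<inter> C i) = c i}
      = (\<Prod>i<r. exp (- measure (chl_intensity N) (C i)) * measure (chl_intensity N) (C i) ^ c i / fact (c i))"
    and "{\<omega> \<in> space M. \<forall>i<r. card (points \<omega> \<inter> C i) = c i} \<in> events"
proof -
  let ?X = "\<lambda>i \<omega>. card (points \<omega> \<inter> C i)"
  have pp: "?X i \<in> measurable M (count_space UNIV)"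
    "prob {\<omega> \<in> space M. ?X i \<omega> = n} = exp (- measure (chl_intensity N) (C i)) * measure (chl_intensity N) (C i) ^ n / fact n"
    if "i < r" for i n
    using poisson assms(1,2)[OF that] unfolding poisson_point_process_def by blast+
  have "indep_vars (\<lambda>_. count_space UNIV) ?X {..<r}"
  proof -
    have "\<forall>(r :: nat) A. (\<forall>i<r. A i \<in> sets (chl_intensity N) \<and> emeasure (chl_intensity N) (A i) < \<infinity>) \<and>
        disjoint_family_on A {..<r} \<longrightarrow>
        indep_vars (\<lambda>_. count_space UNIV) (\<lambda>i \<omega>. card (points \<omega> \<inter> A i)) {..<r}"
      using poisson unfolding poisson_point_process_def by (elim conjE)
    from spec[OF spec[OF this, of r], of C] assms(1-3) show ?thesis by simp
  qed
  then have "prob (\<Inter>i\<in>{..<r}. ?X i -` {c i} \<inter> space M) = (\<Prod>i<r. prob (?X i -` {c i} \<inter> space M))"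
    using assms(4) by (intro indep_varsD) auto
  moreover have "(\<Inter>i\<in>{..<r}. ?X i -` {c i} \<inter> space M) = {\<omega> \<in> space M. \<forall>i<r. ?X i \<omega> = c i}"
    using assms(4) by auto
  moreover have "?X i -` {c i} \<inter> space M = {\<omega> \<in> space M. ?X i \<omega> = c i}" for i by auto
  ultimately show "prob {\<omega> \<in> space M. \<forall>i<r. card (points \<omega> \<inter> C i) = c i}
      = (\<Prod>i<r. exp (- measure (chl_intensity N) (C i)) * measure (chl_intensity N) (C i) ^ c i / fact (c i))"
    using pp by simp
  have "{\<omega> \<in> space M. ?X i \<omega> = c i} \<in> events" if "i < r" for i
    using measurable_sets[OF pp(1)[OF that], of "{c i}"] by (simp add: vimage_def Int_def conj_commute)
  then have "{\<omega> \<in> space M. \<forall>i\<in>{..<r}. ?X i \<omega> = c i} \<in> events"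
    by (intro sets.sets_Collect_finite_All) auto
  then show "{\<omega> \<in> space M. \<forall>i<r. card (points \<omega> \<inter> C i) = c i} \<in> events"
    by (simp only: Ball_def lessThan_iff)
qed

text \<open>The boxes A i \<times> B i and the remainder V partition [0, K) \<times> [0, L), so the
  exponential factors multiply to exp (- K L). The sets B i survive only through the product of
  their lengths, which is the source of the independence of the centres.\<close>

lemma prob_cells:
  fixes A B :: "nat \<Rightarrow> real set"
  assumes A: "\<And>i. i < m \<Longrightarrow> A i \<subseteq> {0..<K}" "\<And>i. i < m \<Longrightarrow> A i \<in> sets borel"
    and less: "\<And>i j s t. i < j \<Longrightarrow> j < m \<Longrightarrow> s \<in> A i \<Longrightarrow> t \<in> A j \<Longrightarrow> s < t"
    and B: "\<And>i. i < m \<Longrightarrow> B i \<subseteq> {0..<L}" "\<And>i. i < m \<Longrightarrow> B i \<in> sets borel"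
    and K: "K \<ge> 0"
  shows "prob {\<omega> \<in> space M. (\<forall>i<m. T (Suc i) \<omega> \<in> A i \<and> X (Suc i) \<omega> \<in> B i) \<and> K \<le> T (Suc m) \<omega>}
      = exp (- (K * L)) * (\<Prod>i<m. measure lborel (A i)) * (\<Prod>i<m. measure lborel (B i))"
proof -
  let ?\<mu> = "chl_intensity N"
  define V where "V = {0..<K} \<times> {0..<L} - (\<Union>i<m. A i \<times> B i)"
  \<comment> \<open>The index m stands for the remainder, which must contain no point.\<close>
  define C where "C = (\<lambda>i. if i < m then A i \<times> B i else V)"
  define c :: "nat \<Rightarrow> nat" where "c = (\<lambda>i. if i < m then 1 else 0)"
  have finA: "emeasure lborel (A i) < \<infinity>" if "i < m" for i
    using emeasure_mono[of "A i" "{0..<K}" lborel] A(1)[OF that] K by (simp add: le_less_trans)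
  have finB: "emeasure lborel (B i) < \<infinity>" if "i < m" for i
    using emeasure_mono[of "B i" "{0..<L}" lborel] B(1)[OF that] L_pos by (simp add: le_less_trans)
  have A0: "A i \<subseteq> {0..}" if "i < m" for i using A(1)[OF that] by auto
  have AB: "A i \<times> B i \<in> sets ?\<mu>" "emeasure ?\<mu> (A i \<times> B i) = emeasure lborel (A i) * emeasure lborel (B i)"
    if "i < m" for i
    using chl_intensity_Times[of "A i" "B i"] A(2) A0 B that by auto
  have mAB: "measure ?\<mu> (A i \<times> B i) = measure lborel (A i) * measure lborel (B i)" if "i < m" for i
    using AB(2)[OF that] by (simp add: measure_def enn2real_mult)
  have box: "{0..<K} \<times> {0..<L} \<in> sets ?\<mu>" "emeasure ?\<mu> ({0..<K} \<times> {0..<L}) = ennreal (K * L)"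
    using chl_intensity_Times[of "{0..<K}" "{0..<L}"] K L_pos
    by (auto simp: ennreal_mult subset_iff)
  have U: "(\<Union>i<m. A i \<times> B i) \<in> sets ?\<mu>" using AB by auto
  have sub: "(\<Union>i<m. A i \<times> B i) \<subseteq> {0..<K} \<times> {0..<L}" using A(1) B(1) by fastforce
  have V: "V \<in> sets ?\<mu>" unfolding V_def using box U by auto
  have disjA: "A i \<inter> A j = {}" if "i < m" "j < m" "i \<noteq> j" for i j
    using less that by (metis disjoint_iff less_irrefl linorder_neqE_nat)
  have disj: "disjoint_family_on (\<lambda>i. A i \<times> B i) {..<m}"
    using disjA by (fastforce simp: disjoint_family_on_def)
  have finC: "emeasure ?\<mu> (C i) < \<infinity>" for i
  proof -
    have "C i \<subseteq> {0..<K} \<times> {0..<L}" using sub by (auto simp: C_def V_def)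
    then have "emeasure ?\<mu> (C i) \<le> ennreal (K * L)" using box by (metis emeasure_mono)
    then show ?thesis by (simp add: le_less_trans)
  qed
  have "measure ?\<mu> (\<Union>i<m. A i \<times> B i) = (\<Sum>i<m. measure ?\<mu> (A i \<times> B i))"
    using AB finA finB disj
    by (intro measure_finite_Union) (auto simp: ennreal_mult_eq_top_iff simp flip: less_top)
  moreover have "measure ?\<mu> V = measure ?\<mu> ({0..<K} \<times> {0..<L}) - measure ?\<mu> (\<Union>i<m. A i \<times> B i)"
    unfolding V_def using box U sub by (intro measure_Diff) auto
  moreover have "measure ?\<mu> ({0..<K} \<times> {0..<L}) = K * L"
    using box(2) K L_pos by (simp add: measure_def)
  ultimately have mV: "measure ?\<mu> V = K * L - (\<Sum>i<m. measure lborel (A i) * measure lborel (B i))"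
    using mAB by simp
  have disjC: "disjoint_family_on C {..<Suc m}"
    unfolding disjoint_family_on_def
  proof (intro ballI impI)
    fix i j assume ij: "i \<in> {..<Suc m}" "j \<in> {..<Suc m}" "i \<noteq> j"
    have "(A i \<times> B i) \<inter> V = {}" if "i < m" for i using that by (auto simp: V_def)
    then show "C i \<inter> C j = {}"
      using ij disjA[of i j] by (auto simp: C_def less_Suc_eq)
  qed
  have eqv: "(\<forall>i<Suc m. card (points \<omega> \<inter> C i) = c i) \<longleftrightarrow>
      (\<forall>i<m. card (points \<omega> \<inter> A i \<times> B i) = 1) \<and> card (points \<omega> \<inter> V) = 0" for \<omega>
    by (auto simp: C_def c_def less_Suc_eq)
  have ev: "{\<omega> \<in> space M. (\<forall>i<m. T (Suc i) \<omega> \<in> A i \<and> X (Suc i) \<omega> \<in> B i) \<and> K \<le> T (Suc m) \<omega>} \<in> events"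
  proof -
    have "{\<omega> \<in> space M. T (Suc i) \<omega> \<in> A i \<and> X (Suc i) \<omega> \<in> B i} \<in> events" if "i < m" for i
    proof -
      have [measurable]: "A i \<in> sets borel" "B i \<in> sets borel" using A B that by auto
      show ?thesis by measurable
    qed
    then have [measurable]: "{\<omega> \<in> space M. \<forall>i\<in>{..<m}. T (Suc i) \<omega> \<in> A i \<and> X (Suc i) \<omega> \<in> B i} \<in> events"
      by (intro sets.sets_Collect_finite_All) auto
    have "{\<omega> \<in> space M. (\<forall>i<m. T (Suc i) \<omega> \<in> A i \<and> X (Suc i) \<omega> \<in> B i) \<and> K \<le> T (Suc m) \<omega>}
       = {\<omega> \<in> space M. \<forall>i\<in>{..<m}. T (Suc i) \<omega> \<in> A i \<and> X (Suc i) \<omega> \<in> B i} \<inter> {\<omega> \<in> space M. K \<le> T (Suc m) \<omega>}"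
      by auto
    then show ?thesis by simp
  qed
  have Cs: "C i \<in> sets ?\<mu>" for i using AB V by (simp add: C_def)
  have "prob {\<omega> \<in> space M. (\<forall>i<m. T (Suc i) \<omega> \<in> A i \<and> X (Suc i) \<omega> \<in> B i) \<and> K \<le> T (Suc m) \<omega>}
      = prob {\<omega> \<in> space M. \<forall>i<Suc m. card (points \<omega> \<inter> C i) = c i}"
  proof (rule measure_eq_AE[OF _ ev])
    show "{\<omega> \<in> space M. \<forall>i<Suc m. card (points \<omega> \<inter> C i) = c i} \<in> events"
      using Cs finC disjC by (intro prob_counts(2)) auto
    show "AE \<omega> in M. \<omega> \<in> {\<omega> \<in> space M. (\<forall>i<m. T (Suc i) \<omega> \<in> A i \<and> X (Suc i) \<omega> \<in> B i) \<and> K \<le> T (Suc m) \<omega>} \<longleftrightarrow>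
      \<omega> \<in> {\<omega> \<in> space M. \<forall>i<Suc m. card (points \<omega> \<inter> C i) = c i}"
      using AE_good
    proof eventually_elim
      case (elim \<omega>)
      show ?case
        unfolding mem_Collect_eq eqv V_def
        using points_in_cells_iff[of "\<lambda>n. T n \<omega>" "\<lambda>n. X n \<omega>" "{0..<L}" K m A B] elim A(1) less
        by blast
    qed
  qed
  also have "\<dots> = (\<Prod>i<Suc m. exp (- measure ?\<mu> (C i)) * measure ?\<mu> (C i) ^ c i / fact (c i))"
    using Cs finC disjC by (intro prob_counts(1)) auto
  also have "\<dots> = (\<Prod>i<m. exp (- (measure lborel (A i) * measure lborel (B i))) * (measure lborel (A i) * measure lborel (B i))) * exp (- measure ?\<mu> V)"
    by (simp add: C_def c_def mAB)
  also have "\<dots> = exp (- (\<Sum>i<m. measure lborel (A i) * measure lborel (B i))) * exp (- measure ?\<mu> V) *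
      ((\<Prod>i<m. measure lborel (A i)) * (\<Prod>i<m. measure lborel (B i)))"
    by (simp add: prod.distrib exp_sum sum_negf[symmetric])
  also have "exp (- (\<Sum>i<m. measure lborel (A i) * measure lborel (B i))) * exp (- measure ?\<mu> V) = exp (- (K * L))"
    by (simp add: mV flip: exp_add)
  finally show ?thesis by (simp add: mult.assoc)
qed

end

section \<open>The centres are independent and uniform\<close>

lemma nat_floor_divide_eq_iff:
  fixes t h :: real
  assumes "t > 0" "h > 0"
  shows "nat \<lfloor>t / h\<rfloor> = q \<longleftrightarrow> t \<in> {real q * h..<(real q + 1) * h}"
    and "q < nat \<lfloor>t / h\<rfloor> \<longleftrightarrow> (real q + 1) * h \<le> t"
proof -
  have "nat \<lfloor>t / h\<rfloor> = q \<longleftrightarrow> \<lfloor>t / h\<rfloor> = int q" using assms by (auto simp: nat_eq_iff)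
  also have "\<dots> \<longleftrightarrow> real q \<le> t / h \<and> t / h < real q + 1" by (simp add: floor_eq_iff)
  also have "\<dots> \<longleftrightarrow> t \<in> {real q * h..<(real q + 1) * h}"
    using assms by (simp add: pos_le_divide_eq pos_divide_less_eq)
  finally show "nat \<lfloor>t / h\<rfloor> = q \<longleftrightarrow> t \<in> {real q * h..<(real q + 1) * h}" .
  have "q < nat \<lfloor>t / h\<rfloor> \<longleftrightarrow> int q + 1 \<le> \<lfloor>t / h\<rfloor>" by (simp add: zless_nat_eq_int_zless)  linarith
  also have "\<dots> \<longleftrightarrow> real q + 1 \<le> t / h" by (simp add: le_floor_iff)
  also have "\<dots> \<longleftrightarrow> (real q + 1) * h \<le> t" using assms by (simp add: pos_le_divide_eq)
  finally show "q < nat \<lfloor>t / h\<rfloor> \<longleftrightarrow> (real q + 1) * h \<le> t" .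
qed

lemma nat_floor_less:
  fixes a b r :: real
  assumes "0 < a" "0 < r" "1 \<le> r * (b - a)"
  shows "nat \<lfloor>a * r\<rfloor> < nat \<lfloor>b * r\<rfloor>"
proof -
  have "a * r + 1 \<le> b * r" using assms(3) by (simp add: algebra_simps)
  then have "\<lfloor>a * r\<rfloor> + 1 \<le> \<lfloor>b * r\<rfloor>" using floor_mono by fastforce
  moreover have "0 \<le> \<lfloor>a * r\<rfloor>" using assms by simp
  ultimately show ?thesis by (subst nat_less_eq_zless) linarith+
qed

context chl_process
begin

lemma AE_T_pos: "AE \<omega> in M. \<forall>n\<ge>1. 0 < T n \<omega>"
  using AE_good
proof eventually_elim
  case (elim \<omega>)
  have "0 < T n \<omega>" if "n \<ge> 1" for n
    using that
  proof (induction n rule: dec_induct)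
    case (step n)
    with elim show ?case by (meson less_trans)
  qed (use elim in simp)
  then show ?case by blast
qed

lemma AE_T_less: "AE \<omega> in M. \<forall>n\<ge>1. T n \<omega> < T (Suc n) \<omega>"
  using AE_good by (rule AE_mp) (intro AE_I2 impI, elim conjE)

lemma AE_X_range: "AE \<omega> in M. \<forall>n\<ge>1. X n \<omega> \<in> {0..<L}"
  using AE_good by (rule AE_mp) (intro AE_I2 impI, elim conjE)

text \<open>
  With time divided into cells of length \<open>h\<close>, the first \<open>m + 1\<close> points lie in distinct cells. This event
  has probability tending to 1 as \<open>h\<close> tends to 0, and on it the order of the points can be read off from counts.
\<close>

definition separated :: "real \<Rightarrow> nat \<Rightarrow> 'w \<Rightarrow> bool" where
  "separated h m \<omega> \<longleftrightarrow> (\<forall>j<m. nat \<lfloor>T (Suc j) \<omega> / h\<rfloor> < nat \<lfloor>T (Suc (Suc j)) \<omega> / h\<rfloor>)"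

text \<open>Recorded as a list because lists of naturals form a countable type, so that
  probabilities can be summed over all values.\<close>

definition cells :: "real \<Rightarrow> nat \<Rightarrow> 'w \<Rightarrow> nat list" where
  "cells h m \<omega> = map (\<lambda>j. nat \<lfloor>T (Suc j) \<omega> / h\<rfloor>) [0..<m]"

lemma cells_eq_iff:
  "cells h m \<omega> = l \<longleftrightarrow> length l = m \<and> (\<forall>j<m. nat \<lfloor>T (Suc j) \<omega> / h\<rfloor> = l ! j)"
  by (auto simp: cells_def list_eq_iff_nth_eq)

lemma separated_sets [measurable]: "{\<omega> \<in> space M. separated h m \<omega>} \<in> events"
proof -
  have "{\<omega> \<in> space M. \<forall>j\<in>{..<m}. nat \<lfloor>T (Suc j) \<omega> / h\<rfloor> < nat \<lfloor>T (Suc (Suc j)) \<omega> / h\<rfloor>} \<in> events"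
    by (intro sets.sets_Collect_finite_All) auto
  then show ?thesis by (simp add: separated_def)
qed

lemma cells_sets [measurable]: "{\<omega> \<in> space M. cells h m \<omega> = l} \<in> events"
proof (cases "length l = m")
  case True
  have "{\<omega> \<in> space M. \<forall>j\<in>{..<m}. nat \<lfloor>T (Suc j) \<omega> / h\<rfloor> = l ! j} \<in> events"
    by (intro sets.sets_Collect_finite_All) auto
  then show ?thesis using True by (simp add: cells_eq_iff)
qed (simp add: cells_eq_iff)

lemma X_in_sets:
  assumes "\<And>j. j < m \<Longrightarrow> B j \<in> sets borel"
  shows "{\<omega> \<in> space M. \<forall>j<m. X (Suc j) \<omega> \<in> B j} \<in> events"
proof -
  have "{\<omega> \<in> space M. X (Suc j) \<omega> \<in> B j} \<in> events" if "j < m" for j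
  proof -
    have [measurable]: "B j \<in> sets borel" using assms that .
    show ?thesis by measurable
  qed
  then have "{\<omega> \<in> space M. \<forall>j\<in>{..<m}. X (Suc j) \<omega> \<in> B j} \<in> events"
    by (intro sets.sets_Collect_finite_All) auto
  then show ?thesis by (simp only: Ball_def lessThan_iff)
qed

text \<open>The identity is cross-multiplied so that the time factor, common to every choice of the
  spatial sets, need not be evaluated. Only strictly increasing lists carry mass.\<close>

lemma prob_separated_cells:
  assumes h: "h > 0" and B: "\<And>j. j < m \<Longrightarrow> B j \<in> sets borel" "\<And>j. j < m \<Longrightarrow> B j \<subseteq> {0..<L}"
  shows "prob {\<omega> \<in> space M. (separated h m \<omega> \<and> (\<forall>j<m. X (Suc j) \<omega> \<in> B j)) \<and> cells h m \<omega> = l} * L ^ m =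
    prob {\<omega> \<in> space M. (separated h m \<omega> \<and> (\<forall>j<m. X (Suc j) \<omega> \<in> {0..<L})) \<and> cells h m \<omega> = l} *
      (\<Prod>j<m. measure lborel (B j))"
proof (cases "length l = m \<and> sorted_wrt (<) l \<and> m > 0")
  case True
  \<comment> \<open>The right end of the last occupied cell: once the cells of the first m points
    are known, separation says that the next point comes at or after this time.\<close>
  let ?K = "(real (l ! (m - 1)) + 1) * h"
  define A where "A = (\<lambda>i. {real (l ! i) * h..<(real (l ! i) + 1) * h})"
  have l_mono: "l ! i < l ! j" if "i < j" "j < m" for i j
    using True that sorted_wrt_nth_less by metis
  have A_less: "s < t" if ij: "i < j" "j < m" and s: "s \<in> A i" and t: "t \<in> A j" for i j s t
  proof -
    have "real (l ! i) + 1 \<le> real (l ! j)" using l_mono[OF ij] by linarith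
    then have "(real (l ! i) + 1) * h \<le> real (l ! j) * h" using h by simp
    then show ?thesis using s t unfolding A_def by (meson atLeastLessThan_iff less_le_trans)
  qed
  have A_sub: "A i \<subseteq> {0..<?K}" if "i < m" for i
  proof -
    have "l ! i \<le> l ! (m - 1)"
    proof (cases "i = m - 1")
      case False
      then have "i < m - 1" "m - 1 < m" using that by linarith+
      then show ?thesis by (intro less_imp_le l_mono)
    qed simp
    then have "(real (l ! i) + 1) * h \<le> ?K" using h by simp
    moreover have "0 \<le> real (l ! i) * h" using h by simp
    ultimately show ?thesis unfolding A_def by (intro ivl_subset[THEN iffD2]) blast
  qed
  have eq: "prob {\<omega> \<in> space M. (separated h m \<omega> \<and> (\<forall>j<m. X (Suc j) \<omega> \<in> B j)) \<and> cells h m \<omega> = l}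
      = exp (- (?K * L)) * (\<Prod>i<m. measure lborel (A i)) * (\<Prod>i<m. measure lborel (B i))"
    if B: "\<And>j. j < m \<Longrightarrow> B j \<in> sets borel" "\<And>j. j < m \<Longrightarrow> B j \<subseteq> {0..<L}" for B :: "nat \<Rightarrow> real set"
  proof -
    have "prob {\<omega> \<in> space M. (separated h m \<omega> \<and> (\<forall>j<m. X (Suc j) \<omega> \<in> B j)) \<and> cells h m \<omega> = l}
      = prob {\<omega> \<in> space M. (\<forall>i<m. T (Suc i) \<omega> \<in> A i \<and> X (Suc i) \<omega> \<in> B i) \<and> ?K \<le> T (Suc m) \<omega>}"
    proof (rule measure_eq_AE)
      show "{\<omega> \<in> space M. (separated h m \<omega> \<and> (\<forall>j<m. X (Suc j) \<omega> \<in> B j)) \<and> cells h m \<omega> = l} \<in> events"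
        by (intro sets.sets_Collect_conj separated_sets cells_sets X_in_sets B)
      have "{\<omega> \<in> space M. \<forall>i\<in>{..<m}. T (Suc i) \<omega> \<in> A i} \<in> events"
        unfolding A_def by (intro sets.sets_Collect_finite_All) auto
      then have *: "{\<omega> \<in> space M. \<forall>i<m. T (Suc i) \<omega> \<in> A i} \<in> events"
        "{\<omega> \<in> space M. \<forall>i<m. X (Suc i) \<omega> \<in> B i} \<in> events"
        using X_in_sets[OF B(1)] by (simp_all only: Ball_def lessThan_iff)
      have "{\<omega> \<in> space M. (\<forall>i<m. T (Suc i) \<omega> \<in> A i \<and> X (Suc i) \<omega> \<in> B i) \<and> ?K \<le> T (Suc m) \<omega>} =
        {\<omega> \<in> space M. (\<forall>i<m. T (Suc i) \<omega> \<in> A i) \<and> (\<forall>i<m. X (Suc i) \<omega> \<in> B i) \<and> ?K \<le> T (Suc m) \<omega>}" by auto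
      also have "\<dots> \<in> events"
        by (intro sets.sets_Collect_conj *) measurable
      finally show "{\<omega> \<in> space M. (\<forall>i<m. T (Suc i) \<omega> \<in> A i \<and> X (Suc i) \<omega> \<in> B i) \<and> ?K \<le> T (Suc m) \<omega>} \<in> events" .
      show "AE \<omega> in M. \<omega> \<in> {\<omega> \<in> space M. (separated h m \<omega> \<and> (\<forall>j<m. X (Suc j) \<omega> \<in> B j)) \<and> cells h m \<omega> = l} \<longleftrightarrow>
        \<omega> \<in> {\<omega> \<in> space M. (\<forall>i<m. T (Suc i) \<omega> \<in> A i \<and> X (Suc i) \<omega> \<in> B i) \<and> ?K \<le> T (Suc m) \<omega>}"
        using AE_T_pos
      proof eventually_elim
        case (elim \<omega>)
        have pos: "0 < T (Suc j) \<omega>" for j using elim by simp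
        have c: "cells h m \<omega> = l \<longleftrightarrow> (\<forall>j<m. T (Suc j) \<omega> \<in> A j)"
          using True unfolding cells_eq_iff nat_floor_divide_eq_iff(1)[OF pos h] A_def by simp
        have s: "separated h m \<omega> \<longleftrightarrow> ?K \<le> T (Suc m) \<omega>" if "cells h m \<omega> = l"
        proof -
          have f: "nat \<lfloor>T (Suc j) \<omega> / h\<rfloor> = l ! j" if "j < m" for j
            using \<open>cells h m \<omega> = l\<close> that by (simp add: cells_eq_iff)
          have "separated h m \<omega> \<longleftrightarrow> l ! (m - 1) < nat \<lfloor>T (Suc m) \<omega> / h\<rfloor>"
          proof
            assume "separated h m \<omega>"
            moreover have "m - 1 < m" "Suc (m - 1) = m" using True by auto
            ultimately show "l ! (m - 1) < nat \<lfloor>T (Suc m) \<omega> / h\<rfloor>"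
              using f[of "m - 1"] unfolding separated_def by metis
          next
            assume *: "l ! (m - 1) < nat \<lfloor>T (Suc m) \<omega> / h\<rfloor>"
            show "separated h m \<omega>"
              unfolding separated_def
            proof (intro allI impI)
              fix j assume j: "j < m"
              show "nat \<lfloor>T (Suc j) \<omega> / h\<rfloor> < nat \<lfloor>T (Suc (Suc j)) \<omega> / h\<rfloor>"
              proof (cases "Suc j = m")
                case True
                then have "m - 1 = j" by simp
                with * True f[OF j] show ?thesis by simp
              next
                case False
                then have "Suc j < m" using j by simp
                then show ?thesis using f[OF j] f[of "Suc j"] l_mono[of j "Suc j"] by simp
              qed
            qed
          qed
          then show ?thesis by (simp only: nat_floor_divide_eq_iff(2)[OF pos h])
        qed
        show ?case using c s by blast
      qed
    qed
    also have "\<dots> = exp (- (?K * L)) * (\<Prod>i<m. measure lborel (A i)) * (\<Prod>i<m. measure lborel (B i))"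
    proof (rule prob_cells)
      show "A i \<in> sets borel" for i by (simp add: A_def)
      show "0 \<le> ?K" using h by simp
    qed ((rule A_sub A_less B; assumption)+)
    finally show ?thesis .
  qed
  have "measure lborel {0..<L} = L" using L_pos by simp
  then show ?thesis
    using eq[OF B] eq[of "\<lambda>_. {0..<L}"] by simp
next
  case False
  show ?thesis
  proof (cases "m = 0")
    case True
    then show ?thesis by simp
  next
    case m: False
    have "\<not> (separated h m \<omega> \<and> cells h m \<omega> = l)" for \<omega>
    proof
      assume *: "separated h m \<omega> \<and> cells h m \<omega> = l"
      then have len: "length l = m" and f: "\<And>j. j < m \<Longrightarrow> nat \<lfloor>T (Suc j) \<omega> / h\<rfloor> = l ! j"
        by (auto simp: cells_eq_iff)
      have "l ! j < l ! Suc j" if "Suc j < m" for j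
        using * f[of j] f[of "Suc j"] that Suc_lessD[OF that] unfolding separated_def by metis
      then have "sorted_wrt (<) l"
        using len by (subst sorted_wrt_iff_nth_Suc_transp) (auto simp: transp_def)
      with False len m show False by simp
    qed
    then have "{\<omega> \<in> space M. (separated h m \<omega> \<and> (\<forall>j<m. X (Suc j) \<omega> \<in> C j)) \<and> cells h m \<omega> = l} = {}" for C
      by blast
    then show ?thesis by (simp only: measure_empty mult_zero_left)
  qed
qed

text \<open>Summation over all cell lists, carried out as an integral over
  \<open>count_space\<close> in the extended nonnegative reals, where convergence is
  automatic.\<close>

lemma prob_separated:
  assumes h: "h > 0" and B: "\<And>j. j < m \<Longrightarrow> B j \<in> sets borel" "\<And>j. j < m \<Longrightarrow> B j \<subseteq> {0..<L}"
  shows "prob {\<omega> \<in> space M. separated h m \<omega> \<and> (\<forall>j<m. X (Suc j) \<omega> \<in> B j)} * L ^ m =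
    prob {\<omega> \<in> space M. separated h m \<omega> \<and> (\<forall>j<m. X (Suc j) \<omega> \<in> {0..<L})} * (\<Prod>j<m. measure lborel (B j))"
proof -
  define b where "b = (\<Prod>j<m. measure lborel (B j))"
  have b: "b \<ge> 0" by (simp add: b_def prod_nonneg)
  let ?F = "\<lambda>B. {\<omega> \<in> space M. separated h m \<omega> \<and> (\<forall>j<m. X (Suc j) \<omega> \<in> B j)}"
  let ?E = "\<lambda>B l. {\<omega> \<in> space M. (separated h m \<omega> \<and> (\<forall>j<m. X (Suc j) \<omega> \<in> B j)) \<and> cells h m \<omega> = l}"
  have F: "emeasure M (?F B) = (\<integral>\<^sup>+ l. emeasure M (?E B l) \<partial>count_space UNIV)"
    if "\<And>j. j < m \<Longrightarrow> B j \<in> sets borel" for B :: "nat \<Rightarrow> real set"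
  proof -
    have "?F B = (\<Union>l. ?E B l)" by auto
    then have "emeasure M (?F B) = emeasure M (\<Union>l. ?E B l)" by (rule arg_cong)
    also have "\<dots> = (\<integral>\<^sup>+ l. emeasure M (?E B l) \<partial>count_space UNIV)"
    proof (rule emeasure_UN_countable)
      show "?E B l \<in> events" for l
        by (intro sets.sets_Collect_conj separated_sets cells_sets X_in_sets that)
    qed (auto simp: disjoint_family_on_def)
    finally show ?thesis .
  qed
  have "emeasure M (?F B) * ennreal (L ^ m) = (\<integral>\<^sup>+ l. emeasure M (?E B l) * ennreal (L ^ m) \<partial>count_space UNIV)"
    using F[OF B(1)] by (simp add: nn_integral_multc)
  also have "\<dots> = (\<integral>\<^sup>+ l. emeasure M (?E (\<lambda>_. {0..<L}) l) * ennreal b \<partial>count_space UNIV)"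
    using prob_separated_cells[OF h B] b L_pos
    by (intro nn_integral_cong) (simp add: emeasure_eq_measure b_def flip: ennreal_mult)
  also have "\<dots> = emeasure M (?F (\<lambda>_. {0..<L})) * ennreal b"
    using F[of "\<lambda>_. {0..<L}"] by (simp add: nn_integral_multc)
  finally show ?thesis
    using b L_pos by (simp add: emeasure_eq_measure b_def flip: ennreal_mult)
qed

text \<open>A gap b - a between consecutive times forces different cells as soon as the mesh 1 / (n
  + 1) is at most b - a, and only finitely many gaps are involved.\<close>

lemma AE_eventually_separated: "AE \<omega> in M. \<forall>\<^sub>F n in sequentially. separated (1 / real (Suc n)) m \<omega>"
  using AE_T_less AE_T_pos
proof eventually_elim
  case (elim \<omega>)
  have "\<forall>\<^sub>F n in sequentially. nat \<lfloor>T (Suc j) \<omega> / (1 / real (Suc n))\<rfloor> < nat \<lfloor>T (Suc (Suc j)) \<omega> / (1 / real (Suc n))\<rfloor>" for j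
  proof -
    let ?a = "T (Suc j) \<omega>" and ?b = "T (Suc (Suc j)) \<omega>"
    have lt: "?a < ?b" and pos: "0 < ?a" "0 < ?b" using elim by auto
    obtain n0 :: nat where n0: "1 / (?b - ?a) \<le> real n0" using real_arch_simple by blast
    have "nat \<lfloor>?a / (1 / real (Suc n))\<rfloor> < nat \<lfloor>?b / (1 / real (Suc n))\<rfloor>" if "n \<ge> n0" for n
    proof -
      have "1 / (?b - ?a) \<le> real (Suc n)" using n0 that by linarith
      then have "1 \<le> real (Suc n) * (?b - ?a)" using lt by (simp only: pos_divide_le_eq diff_gt_0_iff_gt)
      from nat_floor_less[OF pos(1) _ this] show ?thesis by (simp only: divide_divide_eq_right) simp
    qed
    then show ?thesis by (auto simp: eventually_sequentially)
  qed
  then have "\<forall>\<^sub>F n in sequentially. \<forall>j\<in>{..<m}. nat \<lfloor>T (Suc j) \<omega> / (1 / real (Suc n))\<rfloor> < nat \<lfloor>T (Suc (Suc j)) \<omega> / (1 / real (Suc n))\<rfloor>"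
    by (intro eventually_ball_finite) auto
  then show ?case by (simp only: separated_def Ball_def lessThan_iff)
qed

text \<open>A finer mesh may put into one cell two points that a coarser mesh separates, so these
  events are not monotone in n; dominated convergence takes the place of continuity from
  below.\<close>

lemma prob_separated_tendsto:
  assumes B: "\<And>j. j < m \<Longrightarrow> B j \<in> sets borel"
  shows "(\<lambda>n. prob {\<omega> \<in> space M. separated (1 / real (Suc n)) m \<omega> \<and> (\<forall>j<m. X (Suc j) \<omega> \<in> B j)})
    \<longlonglongrightarrow> prob {\<omega> \<in> space M. \<forall>j<m. X (Suc j) \<omega> \<in> B j}"
proof -
  define W where "W = {\<omega> \<in> space M. \<forall>j<m. X (Suc j) \<omega> \<in> B j}"
  define F where "F = (\<lambda>n. {\<omega> \<in> space M. separated (1 / real (Suc n)) m \<omega> \<and> (\<forall>j<m. X (Suc j) \<omega> \<in> B j)})"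
  have [measurable]: "W \<in> events" unfolding W_def by (rule X_in_sets[OF B])
  have [measurable]: "F n \<in> events" for n
    unfolding F_def by (intro sets.sets_Collect_conj separated_sets X_in_sets B)
  have "(\<lambda>n. \<integral>\<omega>. indicator (F n) \<omega> \<partial>M) \<longlonglongrightarrow> (\<integral>\<omega>. (indicator W \<omega> :: real) \<partial>M)"
  proof (rule integral_dominated_convergence[where w = "\<lambda>_. 1"])
    show "AE \<omega> in M. (\<lambda>n. indicator (F n) \<omega> :: real) \<longlonglongrightarrow> indicator W \<omega>"
      using AE_eventually_separated[of m]
    proof eventually_elim
      case (elim \<omega>)
      have "indicator (F n) \<omega> = (indicator W \<omega> :: real)" if "separated (1 / real (Suc n)) m \<omega>" for n
        using that unfolding F_def W_def indicator_def by (simp only: mem_Collect_eq simp_thms)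
      then show ?case by (intro tendsto_eventually eventually_mono[OF elim])
    qed
    show "AE \<omega> in M. norm (indicator (F n) \<omega> :: real) \<le> 1" for n
      by (simp add: indicator_def)
  qed simp_all
  moreover have "(\<integral>\<omega>. indicator A \<omega> \<partial>M) = prob A" if "A \<in> events" for A
    using sets.sets_into_space[OF that] by (simp add: Int_absorb2)
  ultimately have "(\<lambda>n. prob (F n)) \<longlonglongrightarrow> prob W" by simp
  then show ?thesis unfolding F_def W_def .
qed

text \<open>In the limit of the cross-multiplied identity the separation event disappears, and the
  comparison event with all spatial sets equal to [0, L) has probability 1. Dividing by L^m gives
  the uniform law; intersecting with [0, L) alters events by null sets only.\<close>

lemma prob_X_uniform:
  assumes B: "\<And>j. j < m \<Longrightarrow> B j \<in> sets borel"
  shows "emeasure M {\<omega> \<in> space M. \<forall>j<m. X (Suc j) \<omega> \<in> B j} = (\<Prod>j<m. emeasure (uniform_circle L) (B j))"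
proof -
  let ?B = "\<lambda>j. B j \<inter> {0..<L}"
  let ?W = "\<lambda>B. {\<omega> \<in> space M. \<forall>j<m. X (Suc j) \<omega> \<in> B j}"
  have B': "\<And>j. j < m \<Longrightarrow> ?B j \<in> sets borel" using B by auto
  have one: "prob (?W (\<lambda>_. {0..<L})) = 1"
  proof (subst prob_eq_1)
    show "?W (\<lambda>_. {0..<L}) \<in> events" by (intro X_in_sets) simp
    show "AE \<omega> in M. \<omega> \<in> ?W (\<lambda>_. {0..<L})"
      using AE_X_range AE_space by eventually_elim simp
  qed
  let ?G = "\<lambda>n B. {\<omega> \<in> space M. separated (1 / real (Suc n)) m \<omega> \<and> (\<forall>j<m. X (Suc j) \<omega> \<in> B j)}"
  have l1: "(\<lambda>n. prob (?G n (\<lambda>_. {0..<L})) * (\<Prod>j<m. measure lborel (?B j)))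
      \<longlonglongrightarrow> prob (?W (\<lambda>_. {0..<L})) * (\<Prod>j<m. measure lborel (?B j))"
    by (rule tendsto_mult[OF prob_separated_tendsto tendsto_const]) simp
  have l2: "(\<lambda>n. prob (?G n ?B) * L ^ m) \<longlonglongrightarrow> prob (?W ?B) * L ^ m"
    by (rule tendsto_mult[OF prob_separated_tendsto[OF B'] tendsto_const])
  have l3: "(\<lambda>n. prob (?G n (\<lambda>_. {0..<L})) * (\<Prod>j<m. measure lborel (?B j))) = (\<lambda>n. prob (?G n ?B) * L ^ m)"
    by (rule ext, rule prob_separated[symmetric, OF _ B']) auto
  have "prob (?W ?B) * L ^ m = prob (?W (\<lambda>_. {0..<L})) * (\<Prod>j<m. measure lborel (?B j))"
    using l1 unfolding l3 by (rule LIMSEQ_unique[OF l2])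
  moreover have "L ^ m \<noteq> 0" using N by simp
  ultimately have "prob (?W ?B) = (\<Prod>j<m. measure lborel (?B j)) / L ^ m"
    unfolding one mult_1 by (intro nonzero_eq_divide_eq[THEN iffD2])
  then have "prob (?W ?B) = (\<Prod>j<m. measure lborel (?B j) / L)"
    by (simp only: prod_dividef prod_constant card_lessThan)
  moreover have "prob (?W B) = prob (?W ?B)"
  proof (rule measure_eq_AE)
    show "AE \<omega> in M. \<omega> \<in> ?W B \<longleftrightarrow> \<omega> \<in> ?W ?B"
      using AE_X_range by eventually_elim simp
  qed (rule X_in_sets, rule B B', assumption)+
  moreover have "emeasure (uniform_circle L) (B j) = ennreal (measure lborel (?B j) / L)" if "j < m" for j
  proof -
    have "emeasure lborel (?B j) \<le> emeasure lborel {0..<L}" by (intro emeasure_mono) auto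
    then have "emeasure lborel (?B j) \<noteq> top" using L_pos by (auto simp: top_unique)
    then have "emeasure lborel (?B j) = ennreal (measure lborel (?B j))"
      by (rule emeasure_eq_ennreal_measure)
    then show ?thesis
      unfolding emeasure_uniform_circle[OF L_pos B[OF that]]
      by (simp only: divide_ennreal measure_nonneg L_pos)
  qed
  ultimately show ?thesis
    using L_pos by (simp only: emeasure_eq_measure) (simp add: prod_ennreal[symmetric])
qed

lemma distr_X_uniform:
  assumes "k \<ge> 1"
  shows "distr M (PiM {k..m} (\<lambda>_. uniform_circle L)) (\<lambda>\<omega>. \<lambda>i\<in>{k..m}. X i \<omega>) = PiM {k..m} (\<lambda>_. uniform_circle L)"
    and "(\<lambda>\<omega>. \<lambda>i\<in>{k..m}. X i \<omega>) \<in> measurable M (PiM {k..m} (\<lambda>_. uniform_circle L))"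
proof -
  let ?U = "uniform_circle L"
  interpret U: prob_space ?U by (intro prob_space_uniform_circle L_pos)
  interpret product_sigma_finite "\<lambda>_::nat. ?U" by standard
  have X_meas: "X i \<in> measurable M ?U" if "i \<ge> 1" for i
    using X_measurable[of "i - 1"] that by (simp add: measurable_cong_sets[OF refl sets_uniform_circle])
  show meas: "(\<lambda>\<omega>. \<lambda>i\<in>{k..m}. X i \<omega>) \<in> measurable M (PiM {k..m} (\<lambda>_. ?U))"
    using assms by (intro measurable_restrict X_meas) auto
  show "distr M (PiM {k..m} (\<lambda>_. ?U)) (\<lambda>\<omega>. \<lambda>i\<in>{k..m}. X i \<omega>) = PiM {k..m} (\<lambda>_. ?U)"
  proof (rule PiM_eqI)
    fix A assume A: "\<And>i. i \<in> {k..m} \<Longrightarrow> A i \<in> sets ?U"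
    \<comment> \<open>Centres with index below k are left free by \<open>UNIV\<close>, whose factor
      is 1; the index is shifted because \<open>prob_X_uniform\<close> numbers the sets from 0 and
      the centres from 1.\<close>
    define B where "B = (\<lambda>j. if Suc j \<in> {k..m} then A (Suc j) else UNIV)"
    have "emeasure (distr M (PiM {k..m} (\<lambda>_. ?U)) (\<lambda>\<omega>. \<lambda>i\<in>{k..m}. X i \<omega>)) (Pi\<^sub>E {k..m} A)
        = emeasure M ((\<lambda>\<omega>. \<lambda>i\<in>{k..m}. X i \<omega>) -` Pi\<^sub>E {k..m} A \<inter> space M)"
      using meas A by (intro emeasure_distr sets_PiM_I_finite) auto
    also have "(\<lambda>\<omega>. \<lambda>i\<in>{k..m}. X i \<omega>) -` Pi\<^sub>E {k..m} A \<inter> space M = {\<omega> \<in> space M. \<forall>i\<in>{k..m}. X i \<omega> \<in> A i}"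
      by (auto simp: PiE_iff)
    also have "\<dots> = {\<omega> \<in> space M. \<forall>j<m. X (Suc j) \<omega> \<in> B j}"
    proof -
      have "(\<forall>i\<in>{k..m}. X i \<omega> \<in> A i) \<longleftrightarrow> (\<forall>j<m. X (Suc j) \<omega> \<in> B j)" for \<omega>
      proof
        assume "\<forall>j<m. X (Suc j) \<omega> \<in> B j"
        show "\<forall>i\<in>{k..m}. X i \<omega> \<in> A i"
        proof
          fix i assume i: "i \<in> {k..m}"
          then obtain j where "i = Suc j" using assms by (cases i) auto
          with i \<open>\<forall>j<m. X (Suc j) \<omega> \<in> B j\<close> show "X i \<omega> \<in> A i" by (auto simp: B_def dest!: spec[of _ j])
        qed
      qed (auto simp: B_def)
      then show ?thesis by simp
    qed
    also have "emeasure M \<dots> = (\<Prod>j<m. emeasure ?U (B j))"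
      using A by (intro prob_X_uniform) (auto simp: B_def)
    also have "\<dots> = (\<Prod>i\<in>{1..m}. if i \<in> {k..m} then emeasure ?U (A i) else 1)"
      by (rule prod.reindex_bij_witness[of _ "\<lambda>i. i - 1" Suc])
        (use U.emeasure_space_1 in \<open>auto simp: B_def\<close>)
    also have "\<dots> = (\<Prod>i\<in>{k..m}. emeasure ?U (A i))"
      using assms by (intro prod.mono_neutral_cong_right) auto
    finally show "emeasure (distr M (PiM {k..m} (\<lambda>_. ?U)) (\<lambda>\<omega>. \<lambda>i\<in>{k..m}. X i \<omega>)) (Pi\<^sub>E {k..m} A) =
       (\<Prod>i\<in>{k..m}. emeasure ?U (A i))" .
  qed auto
qed

end

section \<open>Attachment probabilities\<close>

context chl_process
begin

lemma emeasure_X_offsets: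
  assumes \<sigma>: "\<sigma> \<in> borel_measurable borel"
    and J: "\<And>i. J i \<in> sets borel" and per: "\<And>i x. x + L \<in> J i \<longleftrightarrow> x \<in> J i"
    and k: "1 \<le> k" "k \<le> m"
  shows "{\<omega> \<in> space M. \<forall>i\<in>{k..<m}. back_orbit \<sigma> (\<lambda>n. X n \<omega>) (Suc i) m - X i \<omega> \<in> J i} \<in> events"
    and "emeasure M {\<omega> \<in> space M. \<forall>i\<in>{k..<m}. back_orbit \<sigma> (\<lambda>n. X n \<omega>) (Suc i) m - X i \<omega> \<in> J i}
      = (\<Prod>i\<in>{k..<m}. emeasure (uniform_circle L) (J i))"
proof -
  let ?P = "PiM {k..m} (\<lambda>_. uniform_circle L)"
  define E where "E = {x \<in> space ?P. \<forall>i\<in>{k..<m}. back_orbit \<sigma> x (Suc i) m - x i \<in> J i}"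
  let ?f = "\<lambda>\<omega>. \<lambda>i\<in>{k..m}. X i \<omega>"
  have E: "E \<in> sets ?P" unfolding E_def by (rule offsets_sets[OF \<sigma> J])
  note f = distr_X_uniform(2)[OF k(1), of m]
  have "back_orbit \<sigma> (?f \<omega>) (Suc i) m = back_orbit \<sigma> (\<lambda>n. X n \<omega>) (Suc i) m" if "i \<in> {k..<m}" for i \<omega>
    using that by (intro back_orbit_cong) auto
  then have eq: "?f -` E \<inter> space M = {\<omega> \<in> space M. \<forall>i\<in>{k..<m}. back_orbit \<sigma> (\<lambda>n. X n \<omega>) (Suc i) m - X i \<omega> \<in> J i}"
    using measurable_space[OF f] by (auto simp: E_def)
  show "{\<omega> \<in> space M. \<forall>i\<in>{k..<m}. back_orbit \<sigma> (\<lambda>n. X n \<omega>) (Suc i) m - X i \<omega> \<in> J i} \<in> events"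
    using measurable_sets[OF f E] unfolding eq .
  have "emeasure M (?f -` E \<inter> space M) = emeasure ?P E"
    using emeasure_distr[OF f E] unfolding distr_X_uniform(1)[OF k(1)] by simp
  also have "\<dots> = (\<Prod>i\<in>{k..<m}. emeasure (uniform_circle L) (J i))"
    unfolding E_def by (rule emeasure_offsets[OF L_pos \<sigma> J per k(2)])
  finally show "emeasure M {\<omega> \<in> space M. \<forall>i\<in>{k..<m}. back_orbit \<sigma> (\<lambda>n. X n \<omega>) (Suc i) m - X i \<omega> \<in> J i}
      = (\<Prod>i\<in>{k..<m}. emeasure (uniform_circle L) (J i))"
    unfolding eq .
qed

context
  fixes lam :: real
  assumes lam: "lam > 0"
begin

lemma uniform_slit_except: "emeasure (uniform_circle L) (slit_except N lam) = 0"
  using finite_imp_null_set_lborel[OF finite_slit_except[OF N lam]]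
  by (simp add: emeasure_uniform_circle L_pos slit_except_sets[OF N lam] null_setsD1)

text \<open>Constraining the offset at i alone to the exceptional set leaves a product with a zero
  factor.\<close>

lemma AE_not_except:
  assumes "1 \<le> k"
  shows "AE \<omega> in M. \<forall>i\<in>{k..<m}. back_orbit (slit_real N lam) (\<lambda>n. X n \<omega>) (Suc i) m - X i \<omega> \<notin> slit_except N lam"
proof (rule AE_ball_countable')
  fix i assume i: "i \<in> {k..<m}"
  define J where "J = (\<lambda>l. if l = i then slit_except N lam else UNIV)"
  let ?E = "{\<omega> \<in> space M. \<forall>l\<in>{k..<m}. back_orbit (slit_real N lam) (\<lambda>n. X n \<omega>) (Suc l) m - X l \<omega> \<in> J l}"
  have J: "J l \<in> sets borel" "x + L \<in> J l \<longleftrightarrow> x \<in> J l" for l x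
    using slit_except_sets[OF N lam] slit_periodic(2)[OF N lam] by (auto simp: J_def)
  have "emeasure M ?E = (\<Prod>l\<in>{k..<m}. emeasure (uniform_circle L) (J l))"
    using assms i by (intro emeasure_X_offsets(2) slit_real_measurable[OF N lam] J) auto
  also have "\<dots> = 0"
    using i uniform_slit_except by (intro prod_zero) (auto simp: J_def)
  finally have "?E \<in> null_sets M"
    using emeasure_X_offsets(1)[OF slit_real_measurable[OF N lam] J assms, of m] i by (intro null_setsI) auto
  then have "AE \<omega> in M. \<omega> \<notin> ?E" by (rule AE_not_in)
  with AE_space show "AE \<omega> in M. back_orbit (slit_real N lam) (\<lambda>n. X n \<omega>) (Suc i) m - X i \<omega> \<notin> slit_except N lam"
    by eventually_elim (auto simp: J_def split: if_splits)
qed simp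

text \<open>Direct attachment is written with limits and inverse maps, which hide its measurability.
  This event in terms of offsets is visibly measurable and agrees with it off a null set.\<close>

definition attach_event :: "nat \<Rightarrow> nat \<Rightarrow> 'w set" where
  "attach_event k m = (if k < m then {\<omega> \<in> space M. \<forall>i\<in>{k..<m}.
     back_orbit (slit_real N lam) (\<lambda>n. X n \<omega>) (Suc i) m - X i \<omega> \<in> (if i = k then slit_arc N lam else - slit_arc N lam)} else {})"

text \<open>For m = n + Suc k there are n indices strictly between k and m. Each contributes the
  measure of the complement of the arc, and the index k contributes that of the arc.\<close>

lemma attach_event:
  assumes k: "1 \<le> k"
  shows "attach_event k m \<in> events"
    and "prob (attach_event k (n + Suc k)) = measure (uniform_circle L) (slit_arc N lam) * (1 - measure (uniform_circle L) (slit_arc N lam)) ^ n"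
proof -
  interpret U: prob_space "uniform_circle L" by (intro prob_space_uniform_circle L_pos)
  let ?J = "\<lambda>i. if i = k then slit_arc N lam else - slit_arc N lam"
  have J: "?J i \<in> sets borel" "x + L \<in> ?J i \<longleftrightarrow> x \<in> ?J i" for i x
    using slit_arc_sets[OF N lam] slit_periodic(1)[OF N lam] by auto
  note E = emeasure_X_offsets[OF slit_real_measurable[OF N lam] J k]
  show "attach_event k m \<in> events"
    using E(1)[of m] by (cases "k < m") (simp_all only: attach_event_def if_True if_False less_imp_le sets.empty_sets)
  have compl: "measure (uniform_circle L) (- slit_arc N lam) = 1 - measure (uniform_circle L) (slit_arc N lam)"
    using U.prob_compl[of "slit_arc N lam"] slit_arc_sets[OF N lam] by (simp add: Compl_eq_Diff_UNIV)
  have "emeasure M (attach_event k (n + Suc k)) = (\<Prod>i\<in>{k..<n + Suc k}. emeasure (uniform_circle L) (?J i))"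
    unfolding attach_event_def using E(2)[of "n + Suc k"] by simp
  also have "\<dots> = ennreal (\<Prod>i\<in>{k..<n + Suc k}. measure (uniform_circle L) (?J i))"
    by (simp only: U.emeasure_eq_measure prod_ennreal measure_nonneg)
  finally have "prob (attach_event k (n + Suc k)) = (\<Prod>i\<in>{k..<n + Suc k}. measure (uniform_circle L) (?J i))"
    by (simp add: emeasure_eq_measure prod_nonneg)
  also have "{k..<n + Suc k} = insert k {Suc k..<n + Suc k}" by auto
  also have "(\<Prod>i\<in>insert k {Suc k..<n + Suc k}. measure (uniform_circle L) (?J i)) =
      measure (uniform_circle L) (slit_arc N lam) * (\<Prod>i\<in>{Suc k..<n + Suc k}. measure (uniform_circle L) (- slit_arc N lam))"
    by (subst prod.insert) (auto intro!: prod.cong)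
  finally show "prob (attach_event k (n + Suc k)) = measure (uniform_circle L) (slit_arc N lam) * (1 - measure (uniform_circle L) (slit_arc N lam)) ^ n"
    by (simp add: compl)
qed

lemma prob_attach_event_sums:
  assumes k: "1 \<le> k"
  shows "(\<lambda>m. prob (attach_event k m)) sums 1"
proof -
  interpret U: prob_space "uniform_circle L" by (intro prob_space_uniform_circle L_pos)
  define q where "q = measure (uniform_circle L) (slit_arc N lam)"
  have "emeasure (uniform_circle L) (slit_arc N lam) \<noteq> 0"
    using emeasure_slit_arc_pos[OF N lam] L_pos
    by (simp add: emeasure_uniform_circle slit_arc_sets[OF N lam] ennreal_divide_eq_0_iff)
  then have q: "0 < q" "q \<le> 1"
    using U.prob_le_1 by (auto simp: q_def U.emeasure_eq_measure zero_less_measure_iff)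
  then have "(\<lambda>n. q * (1 - q) ^ n) sums (q * (1 / (1 - (1 - q))))"
    by (intro sums_mult geometric_sums) auto
  then have "(\<lambda>n. prob (attach_event k (n + Suc k))) sums 1"
    unfolding attach_event(2)[OF k] q_def[symmetric] using q by simp
  \<comment> \<open>The geometric series starts at m = Suc k; the terms up to k vanish because
    \<open>attach_event k m\<close> is empty for m \<le> k.\<close>
  then have "(\<lambda>m. prob (attach_event k m)) sums (1 + (\<Sum>m<Suc k. prob (attach_event k m)))"
    by (rule sums_iff_shift[where f = "\<lambda>m. prob (attach_event k m)", THEN iffD1])
  moreover have "(\<Sum>m<Suc k. prob (attach_event k m)) = 0"
    by (intro sum.neutral) (simp add: attach_event_def)
  ultimately show ?thesis by simp
qed

section \<open>Almost sure convergence and the mean\<close>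

lemma AE_attach_event_iff:
  assumes k: "1 \<le> k"
  shows "AE \<omega> in M. \<forall>m. directly_attached N lam (\<lambda>n. X n \<omega>) m k \<longleftrightarrow> \<omega> \<in> attach_event k m"
  unfolding AE_all_countable
proof
  fix m
  show "AE \<omega> in M. directly_attached N lam (\<lambda>n. X n \<omega>) m k \<longleftrightarrow> \<omega> \<in> attach_event k m"
  proof (cases "k < m")
    case True
    from AE_not_except[OF k, of m] AE_space show ?thesis
    proof eventually_elim
      case (elim \<omega>)
      show ?case
        using directly_attached_iff[OF N lam True elim(1)] elim(2) True
        unfolding attach_event_def by (simp only: if_True mem_Collect_eq simp_thms)
    qed
  next
    case False
    then show ?thesis by (simp add: directly_attached_def attach_event_def)
  qed
qed

lemma AE_finite_attach_event:
  assumes k: "1 \<le> k"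
  shows "AE \<omega> in M. finite {m. \<omega> \<in> attach_event k m}"
proof -
  have "AE \<omega> in M. \<forall>\<^sub>F m in sequentially. \<omega> \<in> space M - attach_event k m"
    using attach_event(1)[OF k] prob_attach_event_sums[OF k]
    by (intro borel_cantelli_AE1) (auto simp: sums_iff less_top[symmetric])
  then show ?thesis
  proof eventually_elim
    case (elim \<omega>)
    then obtain m0 where "\<And>m. m \<ge> m0 \<Longrightarrow> \<omega> \<notin> attach_event k m"
      by (auto simp: eventually_sequentially)
    then have "{m. \<omega> \<in> attach_event k m} \<subseteq> {..<m0}" by (auto simp: not_less[symmetric])
    then show ?case by (rule finite_subset) simp
  qed
qed

lemma AE_T_strict_mono: "AE \<omega> in M. \<forall>a b. 1 \<le> a \<longrightarrow> a < b \<longrightarrow> T a \<omega> < T b \<omega>"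
  using AE_T_less
proof eventually_elim
  case (elim \<omega>)
  then show ?case using increasing_from[of 1 "\<lambda>n. T n \<omega>"] by blast
qed

text \<open>The limit is written as a series of indicators so that \<open>integral_suminf\<close>
  evaluates its mean. Almost surely this series is a finite cardinality, and the count is constant
  in t once t has passed the last attachment time.\<close>

lemma num_attached_limit:
  assumes k: "1 \<le> k"
  shows "\<exists>Dinf :: 'w \<Rightarrow> real. Dinf \<in> borel_measurable M \<and>
     (AE \<omega> in M. ((\<lambda>t. real (num_attached N lam T X k t \<omega>)) \<longlongrightarrow> Dinf \<omega>) at_top) \<and>
     integrable M Dinf \<and> (\<integral>\<omega>. Dinf \<omega> \<partial>M) = 1"
proof -
  define f where "f = (\<lambda>m \<omega>. indicator (attach_event k m) \<omega> :: real)"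
  define D where "D = (\<lambda>\<omega>. \<Sum>m. f m \<omega>)"
  note sums = prob_attach_event_sums[OF k]
  have f_int: "integrable M (f m)" for m
    using attach_event(1)[OF k] by (simp add: f_def less_top[symmetric])
  have f_val: "(\<integral>\<omega>. norm (f m \<omega>) \<partial>M) = prob (attach_event k m)" "(\<integral>\<omega>. f m \<omega> \<partial>M) = prob (attach_event k m)" for m
    using sets.sets_into_space[OF attach_event(1)[OF k]] by (simp_all add: f_def Int_absorb2)
  have f_sum: "summable (\<lambda>m. f m \<omega>)" "D \<omega> = real (card {m. \<omega> \<in> attach_event k m})"
    if "finite {m. \<omega> \<in> attach_event k m}" for \<omega>
  proof -
    have z: "f m \<omega> = 0" if "m \<notin> {m. \<omega> \<in> attach_event k m}" for m
      using that by (simp add: f_def)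
    show "summable (\<lambda>m. f m \<omega>)" by (rule summable_finite[OF that z])
    have "D \<omega> = (\<Sum>m\<in>{m. \<omega> \<in> attach_event k m}. f m \<omega>)"
      unfolding D_def by (rule suminf_finite[OF that z])
    also have "\<dots> = (\<Sum>m\<in>{m. \<omega> \<in> attach_event k m}. 1)"
      by (intro sum.cong) (auto simp: f_def)
    finally show "D \<omega> = real (card {m. \<omega> \<in> attach_event k m})" by simp
  qed
  have AE_summable: "AE \<omega> in M. summable (\<lambda>m. norm (f m \<omega>))"
    using AE_finite_attach_event[OF k]
    by eventually_elim (use f_sum(1) in \<open>simp add: f_def\<close>)
  have summ: "summable (\<lambda>m. \<integral>\<omega>. norm (f m \<omega>) \<partial>M)"
    unfolding f_val(1) using sums by (rule sums_summable)
  have D_int: "integrable M D"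
    unfolding D_def by (rule integrable_suminf[OF f_int AE_summable summ])
  moreover have "(\<integral>\<omega>. D \<omega> \<partial>M) = 1"
    unfolding D_def integral_suminf[OF f_int AE_summable summ] f_val(2)
    using sums by (rule sums_unique[symmetric])
  moreover have "AE \<omega> in M. ((\<lambda>t. real (num_attached N lam T X k t \<omega>)) \<longlongrightarrow> D \<omega>) at_top"
    using AE_finite_attach_event[OF k] AE_attach_event_iff[OF k] AE_T_strict_mono
  proof eventually_elim
    case (elim \<omega>)
    note fin = elim(1) and att = elim(2) and mono = elim(3)
    let ?F = "{m. \<omega> \<in> attach_event k m}"
    have "\<forall>\<^sub>F t in at_top. \<forall>m\<in>?F. T m \<omega> \<le> t"
      using elim(1) by (intro eventually_ball_finite ballI eventually_ge_at_top)
    then have "\<forall>\<^sub>F t in at_top. real (num_attached N lam T X k t \<omega>) = D \<omega>"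
    proof eventually_elim
      case (elim t)
      have "{m. T m \<omega> \<in> {T k \<omega><..t} \<and> directly_attached N lam (\<lambda>n. X n \<omega>) m k} = ?F"
      proof (intro set_eqI iffI)
        fix m assume m: "m \<in> ?F"
        then have "k < m" by (auto simp: attach_event_def split: if_splits)
        then have "T k \<omega> < T m \<omega>" using mono k by blast
        with m elim att
        show "m \<in> {m. T m \<omega> \<in> {T k \<omega><..t} \<and> directly_attached N lam (\<lambda>n. X n \<omega>) m k}" by simp
      qed (use att in simp)
      then show ?case by (simp only: num_attached_def f_sum(2)[OF fin])
    qed
    then show ?case by (rule tendsto_eventually)
  qed
  ultimately show ?thesis using borel_measurable_integrable by blast
qed

end

end

theorem corollary1p8:
  fixes M :: "'w measure" and N lam :: real and T X :: "nat \<Rightarrow> 'w \<Rightarrow> real" and k :: nat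
  assumes "N \<ge> 1" and "lam > 0"
    and "chl_driving M N T X"
    and "k \<ge> 1"
  shows "\<exists>Dinf :: 'w \<Rightarrow> real.
           Dinf \<in> borel_measurable M \<and>
           (AE \<omega> in M. ((\<lambda>t. real (num_attached N lam T X k t \<omega>)) \<longlongrightarrow> Dinf \<omega>) at_top) \<and>
           integrable M Dinf \<and>
           (\<integral>\<omega>. Dinf \<omega> \<partial>M) = 1"
proof -
  interpret chl_process M N T X
    using assms by unfold_locales auto
  show ?thesis using num_attached_limit assms by blast
qed

end
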